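(* Let $v\in\mathbb{R}^n$ have all entries positive and let $\tilde R$ be any retraction on $\mathrm{St}(q,n)$. For any $X\in\mathcal{F}_v$, there exists a positive number $\delta_X>0$ such that the mapping $$R_X:\{V\in \mathrm{T}_X\mathcal{F}_v:\|V\|<\delta_X\}\to\mathcal{F}_v,\qquad V\mapsto R_X(V)=P_{\mathcal{F}_v}(\tilde R_X(V)),$$ satisfies the two conditions of the retraction, i.e. $R_X(0_X)=X$ and $\frac{d}{dt}R_X(tV)\big|_{t=0}=V$ for all $V\in \mathrm{T}_X\mathcal{F}_v$. Moreover, if the retraction $\tilde R$ satisfies $\mathrm{span}(\tilde R_X(V))=\mathrm{span}(X+V)$, then the domain of $R$ is the whole tangent bundle of $\mathcal{F}_v$. Such retractions $\tilde R$ include the retraction by QR decomposition, $\tilde R_X(V)=\mathrm{qf}(X+V)$, and the retraction by polar decomposition, $\tilde R_X(V)=(X+V)(I_q+V^TV)^{-1/2}$.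
   Context: $\mathrm{St}(q,n)=\{X\in\mathbb{R}^{n\times q}:X^TX=I_q\}$ and $\mathcal{F}_v=\{X\in\mathrm{St}(q,n): v\in\mathrm{span}(X)\}$, where $\mathrm{span}(X)$ is the column space of $X$. $\mathcal{F}_v$ is an embedded submanifold of $\mathrm{St}(q,n)$ and of $\mathbb{R}^{n\times q}$, with tangent space at $X$ $$\mathrm{T}_X\mathcal{F}_v=\{X\Omega+X_\perp K:\Omega^T=-\Omega,\ K\in\mathbb{R}^{(n-q)\times q},\ KX^Tv=0\},$$ where $X_\perp\in\mathbb{R}^{n\times(n-q)}$ is such that $(X\ X_\perp)$ is an orthogonal matrix. $\|\cdot\|$ is the Frobenius norm. A retraction on a manifold $\mathcal{M}$ is a smooth ($C^\infty$) mapping $R$ from the tangent bundle to $\mathcal{M}$ (its domain need not be the entire tangent bundle) such that, with $R_x$ the restriction of $R$ to $\mathrm{T}_x\mathcal{M}$ and $0_x$ the origin of $\mathrm{T}_x\mathcal{M}$, (i) $R_x(0_x)=x$ for all $x\in\mathcal{M}$, and (ii) $\frac{d}{dt}R_x(t\eta)|_{t=0}=\eta$ for all $\eta\in \mathrm{T}_x\mathcal{M}$. For $Y\in\mathrm{St}(q,n)$ with $Y^Tv\ne0$, $P_{\mathcal{F}_v}(Y)$ denotes the global minimizer of $\|Y-Z\|_F^2$ over $Z\in\mathcal{F}_v$, which is given by $P_{\mathcal{F}_v}(Y)=\frac{v q_*^T}{\|v\|_2}+Y(I_q-q_*q_*^T)$ with $q_*=Y^Tv/\|Y^Tv\|_2$.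 $\mathrm{qf}(A)$ denotes the Q factor of the QR decomposition of $A$ whose R factor has positive diagonal entries. *)

theory Defs
  imports "HOL-Analysis.Analysis"
begin

section \<open>Smooth maps, tangent spaces and retractions\<close>

text \<open>\<open>Ck_on k S f\<close> is meant for open \<open>S\<close>: all iterated directional derivatives up to order \<open>k\<close>
  exist (as Frechet derivatives) and are continuous on \<open>S\<close>.\<close>

primrec Ck_on ::
  "nat \<Rightarrow> 'a::euclidean_space set \<Rightarrow> ('a \<Rightarrow> 'b::euclidean_space) \<Rightarrow> bool" where
  "Ck_on 0 S f \<longleftrightarrow> continuous_on S f"
| "Ck_on (Suc k) S f \<longleftrightarrow>
     (\<forall>x\<in>S. f differentiable (at x)) \<and>
     (\<forall>h. Ck_on k S (\<lambda>x. frechet_derivative f (at x) h))"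

definition smooth_on_open ::
  "'a::euclidean_space set \<Rightarrow> ('a \<Rightarrow> 'b::euclidean_space) \<Rightarrow> bool" where
  "smooth_on_open U f \<longleftrightarrow> open U \<and> (\<forall>k. Ck_on k U f)"

text \<open>Smoothness on an arbitrary subset of a Euclidean space: local existence of smooth extensions.
  On (relatively open subsets of) embedded submanifolds this is smoothness in the sense of
  manifolds.\<close>

definition smooth_map_on ::
  "'a::euclidean_space set \<Rightarrow> ('a \<Rightarrow> 'b::euclidean_space) \<Rightarrow> bool" where
  "smooth_map_on A f \<longleftrightarrow>
     (\<forall>x\<in>A. \<exists>U g. x \<in> U \<and> smooth_on_open U g \<and> (\<forall>y\<in>A \<inter> U. g y = f y))"

text \<open>For an embedded submanifold \<open>M\<close> of a Euclidean space: velocities of smooth curves in \<open>M\<close>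
  through \<open>x\<close>.\<close>

definition tangent_space :: "'a::euclidean_space set \<Rightarrow> 'a \<Rightarrow> 'a set" where
  "tangent_space M x =
     {\<xi>. \<exists>c e. 0 < (e::real) \<and> smooth_on_open {-e<..<e} c \<and> (\<forall>t\<in>{-e<..<e}. c t \<in> M) \<and>
            c 0 = x \<and> (c has_vector_derivative \<xi>) (at 0)}"

definition tangent_bundle :: "'a::euclidean_space set \<Rightarrow> ('a \<times> 'a) set" where
  "tangent_bundle M = {(x, \<xi>). x \<in> M \<and> \<xi> \<in> tangent_space M x}"

text \<open>\<open>D\<close> is the domain of the retraction, a neighbourhood of the zero section in the tangent
  bundle; the values of the total function \<open>R\<close> outside \<open>D\<close> are irrelevant.  Since \<open>D\<close> is
  relatively open, the derivative at \<open>0\<close> only involves values of \<open>R\<close> on \<open>D\<close>.\<close>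

definition manifold_retraction ::
  "'a::euclidean_space set \<Rightarrow> ('a \<times> 'a) set \<Rightarrow> ('a \<Rightarrow> 'a \<Rightarrow> 'a) \<Rightarrow> bool" where
  "manifold_retraction M D R \<longleftrightarrow>
     openin (top_of_set (tangent_bundle M)) D \<and>
     (\<forall>x\<in>M. (x, 0) \<in> D) \<and>
     smooth_map_on D (\<lambda>(x, \<eta>). R x \<eta>) \<and>
     (\<forall>(x, \<eta>)\<in>D. R x \<eta> \<in> M) \<and>
     (\<forall>x\<in>M. R x 0 = x) \<and>
     (\<forall>x\<in>M. \<forall>\<eta>\<in>tangent_space M x.
        ((\<lambda>t. R x (t *\<^sub>R \<eta>)) has_vector_derivative \<eta>) (at 0))"


section \<open>The Stiefel manifold and the set \<open>F\<^sub>v\<close>\<close>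

text \<open>\<open>real ^ 'q ^ 'n\<close> is the type of matrices with \<open>n\<close> rows and \<open>q\<close> columns; its library norm
  is the Frobenius norm.\<close>

definition stiefel :: "(real ^ 'q ^ 'n) set" where
  "stiefel = {X. transpose X ** X = mat 1}"

definition Fv :: "real ^ 'n \<Rightarrow> (real ^ 'q ^ 'n) set" where
  "Fv v = {X \<in> stiefel. v \<in> span (columns X)}"

text \<open>As \<open>n - q\<close> may be zero it cannot be the size of an index type.  A matrix \<open>X\<^sub>\<bottom>\<close> with \<open>n - q\<close>
  columns is given by its columns \<open>P l\<close>, and a matrix with \<open>n - q\<close> rows by its rows \<open>K l\<close>, for
  \<open>l < n - q\<close>.  The next predicate says that the square matrix \<open>(X X\<^sub>\<bottom>)\<close> is orthogonal.\<close>

definition orth_completion :: "real ^ 'q ^ 'n \<Rightarrow> (nat \<Rightarrow> real ^ 'n) \<Rightarrow> bool" where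
  "orth_completion X P \<longleftrightarrow>
     transpose X ** X = mat 1 \<and>
     (\<forall>k<CARD('n) - CARD('q). \<forall>l<CARD('n) - CARD('q). P k \<bullet> P l = (if k = l then 1 else 0)) \<and>
     (\<forall>j. \<forall>l<CARD('n) - CARD('q). column j X \<bullet> P l = 0)"

definition perp_times :: "(nat \<Rightarrow> real ^ 'n) \<Rightarrow> (nat \<Rightarrow> real ^ 'q) \<Rightarrow> real ^ 'q ^ 'n" where
  "perp_times P K = (\<chi> i j. \<Sum>l<CARD('n) - CARD('q). P l $ i * K l $ j)"

text \<open>\<open>{X \<Omega> + X\<^sub>\<bottom> K. \<Omega>\<^sup>T = -\<Omega>, K X\<^sup>T v = 0}\<close>; the set does not depend on the choice of \<open>X\<^sub>\<bottom>\<close>.\<close>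

definition tangent_Fv :: "real ^ 'n \<Rightarrow> real ^ 'q ^ 'n \<Rightarrow> (real ^ 'q ^ 'n) set" where
  "tangent_Fv v X =
     {X ** \<Omega> + perp_times P K | \<Omega> P K.
        orth_completion X P \<and> transpose \<Omega> = - \<Omega> \<and>
        (\<forall>l<CARD('n) - CARD('q). K l \<bullet> (transpose X *v v) = 0)}"

definition tangent_bundle_Fv :: "real ^ 'n \<Rightarrow> ((real ^ 'q ^ 'n) \<times> (real ^ 'q ^ 'n)) set" where
  "tangent_bundle_Fv v = {(X, V). X \<in> Fv v \<and> V \<in> tangent_Fv v X}"


section \<open>The projection onto \<open>F\<^sub>v\<close> and the projected retraction\<close>

text \<open>The minimizer is unique, hence the projection well defined, for \<open>Y\<close> in the following set.\<close>

definition proj_Fv_dom :: "real ^ 'n \<Rightarrow> (real ^ 'q ^ 'n) set" where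
  "proj_Fv_dom v = {Y \<in> stiefel. transpose Y *v v \<noteq> 0}"

definition proj_Fv :: "real ^ 'n \<Rightarrow> real ^ 'q ^ 'n \<Rightarrow> real ^ 'q ^ 'n" where
  "proj_Fv v Y = (THE Z. is_arg_min (\<lambda>Z. (norm (Y - Z))\<^sup>2) (\<lambda>Z. Z \<in> Fv v) Z)"

definition proj_retr ::
  "real ^ 'n \<Rightarrow> (real ^ 'q ^ 'n \<Rightarrow> real ^ 'q ^ 'n \<Rightarrow> real ^ 'q ^ 'n) \<Rightarrow>
   real ^ 'q ^ 'n \<Rightarrow> real ^ 'q ^ 'n \<Rightarrow> real ^ 'q ^ 'n" where
  "proj_retr v R X V = proj_Fv v (R X V)"

text \<open>The natural domain of \<open>proj_retr v R\<close> when \<open>R\<close> has domain \<open>D\<close>.\<close>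

definition proj_retr_dom ::
  "real ^ 'n \<Rightarrow> ((real ^ 'q ^ 'n) \<times> (real ^ 'q ^ 'n)) set \<Rightarrow>
   (real ^ 'q ^ 'n \<Rightarrow> real ^ 'q ^ 'n \<Rightarrow> real ^ 'q ^ 'n) \<Rightarrow>
   ((real ^ 'q ^ 'n) \<times> (real ^ 'q ^ 'n)) set" where
  "proj_retr_dom v D R =
     {(X, V) \<in> tangent_bundle_Fv v. (X, V) \<in> D \<and> R X V \<in> proj_Fv_dom v}"


section \<open>QR and polar decompositions\<close>

definition upper_triangular :: "real ^ ('q::{finite,linorder}) ^ ('q::{finite,linorder}) \<Rightarrow> bool" where
  "upper_triangular R \<longleftrightarrow> (\<forall>i j. j < i \<longrightarrow> R $ i $ j = 0)"

definition qf :: "real ^ ('q::{finite,linorder}) ^ 'n \<Rightarrow> real ^ ('q::{finite,linorder}) ^ 'n" where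
  "qf A = (THE Q. Q \<in> stiefel \<and>
             (\<exists>R. upper_triangular R \<and> (\<forall>i. 0 < R $ i $ i) \<and> A = Q ** R))"

text \<open>The principal square root of a symmetric positive semidefinite matrix.\<close>

definition mat_sqrt :: "real ^ 'q ^ 'q \<Rightarrow> real ^ 'q ^ 'q" where
  "mat_sqrt S = (THE B. transpose B = B \<and> (\<forall>x. 0 \<le> x \<bullet> (B *v x)) \<and> B ** B = S)"

definition polar_retr :: "real ^ 'q ^ 'n \<Rightarrow> real ^ 'q ^ 'n \<Rightarrow> real ^ 'q ^ 'n" where
  "polar_retr X V = (X + V) ** matrix_inv (mat_sqrt (mat 1 + transpose V ** V))"

definition span_preserving ::
  "((real ^ 'q ^ 'n) \<times> (real ^ 'q ^ 'n)) set \<Rightarrow>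
   (real ^ 'q ^ 'n \<Rightarrow> real ^ 'q ^ 'n \<Rightarrow> real ^ 'q ^ 'n) \<Rightarrow> bool" where
  "span_preserving D R \<longleftrightarrow> (\<forall>(X, V)\<in>D. span (columns (R X V)) = span (columns (X + V)))"

end

theory Submission imports Defs begin

text \<open>
  Put \<open>u = v/\<parallel>v\<parallel>\<close>.  For \<open>Z \<in> F\<^sub>v\<close> with \<open>Z p = u\<close>, Pythagoras splits \<open>\<parallel>Y - Z\<parallel>\<^sup>2\<close> into \<open>\<parallel>Y p - u\<parallel>\<^sup>2\<close> and the
  part of \<open>Y - Z\<close> living on the orthogonal complement of \<open>p\<close>; Cauchy--Schwarz then identifies the
  minimizer.  Differentiating its closed form along \<open>t \<mapsto> R\<^sub>X(t V)\<close>, the correction terms collect to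
  \<open>- (V q\<^sub>* + X q\<^sub>*') q\<^sub>*\<^sup>T\<close>, which vanishes for \<open>V\<close> tangent to \<open>F\<^sub>v\<close>.

  For the QR and the polar retraction write \<open>X + t V = Q(t) T(t)\<close>.  Then \<open>T'(0)\<close> is skew, and also
  upper triangular respectively symmetric, hence zero, so that \<open>Q'(0) = V\<close>.  Smoothness comes from the
  Gram--Schmidt recursion for the Q factor, and from the inverse function theorem applied to
  \<open>B \<mapsto> B\<^sup>2\<close>, whose derivative \<open>H \<mapsto> B H + H B\<close> is injective for positive definite \<open>B\<close>.
\<close>

section \<open>Calculus of smooth maps\<close>

text \<open>Tangent vectors are defined as velocities of curves, so every V with X^T V + V^T X = 0
  has to be realised by a smooth curve in \<open>stiefel\<close>; t \<mapsto>
  \<open>qf (X + t *\<^sub>R V)\<close> does this. Hence Gram--Schmidt precedes the tangent spaces,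
  and the column index type carries an order. Afterwards the linear equation stands for the tangent
  space. It turns the Gram matrix of X + V into I + V^T V, so X + V has full rank for every tangent
  V and both factorisations exist on the whole bundle. The inverse function theorem needs open sets
  of matrices, and these contain nonsymmetric ones. Squaring is therefore inverted among all
  positive definite matrices, and symmetry of the root of a symmetric matrix is recovered
  afterwards. The inverse obtained is differentiable once; to reach all orders, inverses of linear
  maps depending on a parameter are studied. For the domain claim: v^T (X + V) X^T v = v^T v for X
  in \<open>Fv v\<close> and V tangent to it, so v is never orthogonal to span(X + V).\<close>

lemma Ck_on_cong:
  assumes "open S" "\<And>x. x \<in> S \<Longrightarrow> f x = g x" "Ck_on k S f"
  shows "Ck_on k S g"
  using assms(2,3)
proof (induction k arbitrary: f g)
  case 0
  then show ?case by (simp cong: continuous_on_cong)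
next
  case (Suc k)
  have d: "(g has_derivative frechet_derivative f (at x)) (at x)" if "x \<in> S" for x
    using has_derivative_transform_within_open[OF _ \<open>open S\<close> that Suc.prems(1)]
      Suc.prems(2) that frechet_derivative_works[of f "at x"] by simp
  have e: "frechet_derivative f (at x) = frechet_derivative g (at x)" if "x \<in> S" for x
    using frechet_derivative_at[OF d[OF that]] .
  have "Ck_on k S (\<lambda>x. frechet_derivative g (at x) h)" for h
  proof (rule Suc.IH)
    show "Ck_on k S (\<lambda>x. frechet_derivative f (at x) h)" using Suc.prems(2) by simp
  qed (simp add: e)
  with d show ?case by (auto simp: differentiable_def)
qed

lemma Ck_on_SucI:
  assumes "open S" "\<And>x. x \<in> S \<Longrightarrow> (f has_derivative f' x) (at x)"
    and "\<And>h. Ck_on k S (\<lambda>x. f' x h)"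
  shows "Ck_on (Suc k) S f"
proof -
  have "Ck_on k S (\<lambda>x. frechet_derivative f (at x) h)" for h
    using assms(2) by (intro Ck_on_cong[OF assms(1) _ assms(3)[of h]]) (metis frechet_derivative_at)
  with assms(2) show ?thesis by (auto simp: differentiable_def)
qed

lemma Ck_on_SucD:
  assumes "Ck_on (Suc k) S f"
  shows "x \<in> S \<Longrightarrow> (f has_derivative frechet_derivative f (at x)) (at x)"
    and "Ck_on k S (\<lambda>x. frechet_derivative f (at x) h)"
  using assms frechet_derivative_works by auto

lemma Ck_on_Suc_imp: "Ck_on (Suc k) S f \<Longrightarrow> Ck_on k S f"
proof (induction k arbitrary: f)
  case 0
  then show ?case
    by (auto intro!: continuous_at_imp_continuous_on differentiable_imp_continuous_within)
next
  case (Suc k)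
  then show ?case by (metis Ck_on.simps(2))
qed

lemma Ck_on_subset: "Ck_on k S f \<Longrightarrow> T \<subseteq> S \<Longrightarrow> Ck_on k T f"
  by (induction k arbitrary: f) (auto intro: continuous_on_subset)

lemma Ck_on_const: "open S \<Longrightarrow> Ck_on k S (\<lambda>x. c)"
proof (induction k arbitrary: c)
  case (Suc k)
  then show ?case by (intro Ck_on_SucI[where f' = "\<lambda>_ _. 0"]) auto
qed simp

lemma Ck_on_bounded_linear:
  assumes "bounded_linear L" "open S"
  shows "Ck_on k S L"
proof (cases k)
  case 0
  then show ?thesis using assms by (simp add: linear_continuous_on)
next
  case (Suc m)
  have "(L has_derivative L) (at x)" for x using assms(1) bounded_linear_imp_has_derivative by auto
  then show ?thesis unfolding Suc
    by (intro Ck_on_SucI[where f' = "\<lambda>_. L"]) (use assms in \<open>auto intro: Ck_on_const\<close>)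
qed

lemma Ck_on_linear: "linear (L :: 'a::euclidean_space \<Rightarrow> 'b::euclidean_space) \<Longrightarrow> open S \<Longrightarrow> Ck_on k S L"
  by (simp add: Ck_on_bounded_linear linear_conv_bounded_linear)

lemma Ck_on_add:
  assumes "open S" "Ck_on k S f" "Ck_on k S g"
  shows "Ck_on k S (\<lambda>x. f x + g x)"
  using assms(2,3)
proof (induction k arbitrary: f g)
  case 0
  then show ?case by (auto intro: continuous_intros)
next
  case (Suc k)
  show ?case
    by (rule Ck_on_SucI[OF assms(1) has_derivative_add[OF Ck_on_SucD(1)[OF Suc.prems(1)] Ck_on_SucD(1)[OF Suc.prems(2)]]])
       (auto intro!: Suc.IH Ck_on_SucD(2)[OF Suc.prems(1)] Ck_on_SucD(2)[OF Suc.prems(2)])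
qed

lemma Ck_on_sum:
  assumes "open S" "\<And>i. i \<in> I \<Longrightarrow> Ck_on k S (f i)"
  shows "Ck_on k S (\<lambda>x. \<Sum>i\<in>I. f i x)"
  using assms(2)
  by (induction I rule: infinite_finite_induct)
     (auto intro: Ck_on_const Ck_on_add simp: assms(1))

lemma Ck_on_bilinear:
  fixes B :: "'a::euclidean_space \<Rightarrow> 'b::euclidean_space \<Rightarrow> 'c::euclidean_space"
  assumes "bounded_bilinear B" "open S" "Ck_on k S f" "Ck_on k S g"
  shows "Ck_on k S (\<lambda>x. B (f x) (g x))"
  using assms(3,4)
proof (induction k arbitrary: f g)
  case 0
  then show ?case using bounded_bilinear.continuous_on[OF assms(1)] by auto
next
  case (Suc k)
  show ?case
    by (rule Ck_on_SucI[OF assms(2) bounded_bilinear.FDERIV[OF assms(1) Ck_on_SucD(1)[OF Suc.prems(1)] Ck_on_SucD(1)[OF Suc.prems(2)]]])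
       (auto intro!: Ck_on_add assms(2) Suc.IH Ck_on_SucD(2)[OF Suc.prems(1)] Ck_on_SucD(2)[OF Suc.prems(2)] Ck_on_Suc_imp[OF Suc.prems(1)] Ck_on_Suc_imp[OF Suc.prems(2)])
qed

lemmas Ck_on_scaleR = Ck_on_bilinear[OF bounded_bilinear_scaleR]
lemmas Ck_on_inner = Ck_on_bilinear[OF bounded_bilinear_inner]

lemma linear_eq_sum_Basis:
  fixes L :: "'a::euclidean_space \<Rightarrow> 'b::real_vector"
  assumes "linear L"
  shows "L y = (\<Sum>b\<in>Basis. (y \<bullet> b) *\<^sub>R L b)"
  by (subst euclidean_representation[of y, symmetric])
     (simp add: linear_sum[OF assms] linear_scale[OF assms])

text \<open>Expanding \<open>y x\<close> in the basis reduces the regularity of an operator-valued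
  map to its values at fixed vectors. Derivatives enter \<open>Ck_on\<close> in exactly this form,
  so the chain rule needs no space of operators.\<close>

lemma Ck_on_linear_apply:
  fixes A :: "'a::euclidean_space \<Rightarrow> 'b::euclidean_space \<Rightarrow> 'c::euclidean_space"
  assumes "open S" "\<And>x. x \<in> S \<Longrightarrow> linear (A x)" "\<And>b. Ck_on k S (\<lambda>x. A x b)" "Ck_on k S y"
  shows "Ck_on k S (\<lambda>x. A x (y x))"
proof (rule Ck_on_cong[OF assms(1)])
  show "Ck_on k S (\<lambda>x. \<Sum>b\<in>Basis. (y x \<bullet> b) *\<^sub>R A x b)"
    by (intro Ck_on_sum Ck_on_scaleR Ck_on_inner assms Ck_on_const)
qed (use assms(2) in \<open>auto intro!: linear_eq_sum_Basis[symmetric]\<close>)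

lemma Ck_on_compose:
  assumes "open S" "open T" "f ` S \<subseteq> T" "Ck_on k S f" "Ck_on k T g"
  shows "Ck_on k S (\<lambda>x. g (f x))"
  using assms(3-5)
proof (induction k arbitrary: f g)
  case 0
  then show ?case using continuous_on_compose2[of T g S f] by simp
next
  case (Suc k)
  have "((\<lambda>x. g (f x)) has_derivative (\<lambda>h. frechet_derivative g (at (f x)) (frechet_derivative f (at x) h))) (at x)"
    if "x \<in> S" for x
    using that Suc.prems(1) by (intro has_derivative_compose[of f _ _ _ g] Ck_on_SucD(1)[OF Suc.prems(2)] Ck_on_SucD(1)[OF Suc.prems(3)]) auto
  moreover have "Ck_on k S (\<lambda>x. frechet_derivative g (at (f x)) (frechet_derivative f (at x) h))" for h
  proof (rule Ck_on_linear_apply[OF assms(1), where A = "\<lambda>x. frechet_derivative g (at (f x))"])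
    show "linear (frechet_derivative g (at (f x)))" if "x \<in> S" for x
      using that Suc.prems(1) Ck_on_SucD(1)[OF Suc.prems(3)] has_derivative_linear by blast
    show "Ck_on k S (\<lambda>x. frechet_derivative g (at (f x)) b)" for b
      using Suc.IH[OF Suc.prems(1) Ck_on_Suc_imp[OF Suc.prems(2)] Ck_on_SucD(2)[OF Suc.prems(3)]] .
    show "Ck_on k S (\<lambda>x. frechet_derivative f (at x) h)"
      by (rule Ck_on_SucD(2)[OF Suc.prems(2)])
  qed
  ultimately show ?case
    by (intro Ck_on_SucI[OF assms(1), where f' = "\<lambda>x h. frechet_derivative g (at (f x)) (frechet_derivative f (at x) h)"])
qed

text \<open>The exponent has to vary in the induction, since differentiation lowers it by
  one.\<close>

lemma Ck_on_powr: "Ck_on k {0<..} (\<lambda>x::real. x powr a)"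
proof (induction k arbitrary: a)
  case 0
  then show ?case by (auto intro!: continuous_intros)
next
  case (Suc k)
  have "((\<lambda>x. x powr a) has_derivative (\<lambda>h. h * (a * x powr (a - 1)))) (at x)" if "x > 0" for x :: real
    using has_real_derivative_powr[OF that, of a] 
    by (simp add: has_field_derivative_def mult.commute[of _ "_ * _"])
  moreover have "Ck_on k {0<..} (\<lambda>x. h * (a * x powr (a - 1)))" for h :: real
    using Ck_on_scaleR[OF _ Ck_on_const[of "{0<..}" k "h * a"] Suc.IH[of "a - 1"]] by (simp add: mult.assoc)
  ultimately show ?case by (intro Ck_on_SucI[where f' = "\<lambda>x h. h * (a * x powr (a - 1))"]) auto
qed

section \<open>Inverses of smoothly varying linear maps and the smooth inverse function
  theorem\<close>

lemma has_derivative_scaleR_vanishing: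
  fixes u :: "'a::real_normed_vector \<Rightarrow> real" and z :: "'a \<Rightarrow> 'b::real_normed_vector"
  assumes "isCont u x" "(z has_derivative z') (at x)" "z x = 0"
  shows "((\<lambda>y. u y *\<^sub>R z y) has_derivative (\<lambda>h. u x *\<^sub>R z' h)) (at x)"
proof -
  obtain K where K: "\<And>h. norm (z' h) \<le> norm h * K"
    using bounded_linear.bounded[OF has_derivative_bounded_linear[OF assms(2)]] by auto
  obtain d where "d > 0" and d: "\<And>y. norm (y - x) < d \<Longrightarrow> norm (z y - z' (y - x)) \<le> norm (y - x)"
    using assms(2,3) unfolding has_derivative_at_alt by (metis diff_zero mult_1 zero_less_one)
  have bound: "norm (z y /\<^sub>R norm (y - x)) \<le> K + 1" if "y \<noteq> x" "norm (y - x) < d" for y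
  proof -
    have "norm (z y) \<le> norm (z y - z' (y - x)) + norm (z' (y - x))" by norm
    also have "\<dots> \<le> (K + 1) * norm (y - x)" using d[OF that(2)] K[of "y - x"] by (simp add: algebra_simps)
    finally show ?thesis using that(1) by (simp add: divide_simps)
  qed
  \<comment> \<open>Because \<open>z x = 0\<close>, this quotient stays bounded; multiplied by
    \<open>u y - u x\<close>, which tends to 0, it tends to 0 as well. Only continuity of
    \<open>u\<close> enters, which matters when \<open>u\<close> is a coordinate of an inverse not
    yet known to be differentiable.\<close>
  have "Bfun (\<lambda>y. z y /\<^sub>R norm (y - x)) (at x)"
    using bound \<open>d > 0\<close> by (intro BfunI[where K = "K + 1"]) (auto simp: eventually_at dist_norm intro!: exI[of _ d])
  moreover have "Zfun (\<lambda>y. u y - u x) (at x)"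
    using assms(1) by (simp add: tendsto_Zfun_iff[symmetric] isCont_def)
  ultimately have "Zfun (\<lambda>y. (u y - u x) *\<^sub>R (z y /\<^sub>R norm (y - x))) (at x)"
    by (intro bounded_bilinear.Zfun_prod_Bfun[OF bounded_bilinear_scaleR])
  then have "((\<lambda>y. norm ((u y - u x) *\<^sub>R (z y /\<^sub>R norm (y - x)))) \<longlongrightarrow> 0) (at x)"
    by (intro tendsto_norm_zero) (simp add: tendsto_Zfun_iff)
  moreover have "norm ((u y - u x) *\<^sub>R (z y /\<^sub>R norm (y - x))) = norm ((u y - u x) *\<^sub>R z y) / norm (y - x)" for y
    by (simp add: divide_inverse abs_mult)
  ultimately have "((\<lambda>y. (u y - u x) *\<^sub>R z y) has_derivative (\<lambda>h. 0)) (at x)"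
    by (simp add: has_derivative_iff_norm assms(3))
  from has_derivative_add[OF this has_derivative_scaleR_right[OF assms(2), of "u x"]]
  show ?thesis by (simp add: algebra_simps)
qed

text \<open>The resolvent identity P x - P x0 = P x0 (A x0 - A x) P x bounds the change of
  \<open>P\<close> by the change of \<open>A\<close> times \<open>P x h\<close> itself. The change
  of \<open>A\<close> is measured on basis vectors only, by \<open>E\<close>.\<close>

lemma continuous_linear_inverse:
  fixes A :: "'a::real_normed_vector \<Rightarrow> 'b::euclidean_space \<Rightarrow> 'b" and P :: "'a \<Rightarrow> 'b \<Rightarrow> 'b"
  assumes "open S" "x0 \<in> S"
    and A: "\<And>x. x \<in> S \<Longrightarrow> linear (A x)" and P: "\<And>x. x \<in> S \<Longrightarrow> linear (P x)"
    and AP: "\<And>x h. x \<in> S \<Longrightarrow> A x (P x h) = h" and PA: "\<And>x h. x \<in> S \<Longrightarrow> P x (A x h) = h"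
    and cont: "\<And>b. isCont (\<lambda>x. A x b) x0"
  shows "isCont (\<lambda>x. P x h) x0"
proof -
  define E where "E x = (\<Sum>b\<in>Basis. norm (P x0 (A x0 b - A x b)))" for x
  have lin: "bounded_linear (P x0)" using P[OF assms(2)] linear_conv_bounded_linear by blast
  have E0: "(E \<longlongrightarrow> 0) (at x0)"
  proof -
    have "(E \<longlongrightarrow> (\<Sum>b\<in>(Basis::'b set). norm (P x0 (A x0 b - A x0 b)))) (at x0)"
      unfolding E_def
      by (intro tendsto_sum tendsto_norm bounded_linear.tendsto[OF lin] tendsto_diff tendsto_const
            cont[unfolded isCont_def])
    then show ?thesis by (simp add: linear_0[OF P[OF assms(2)]])
  qed
  have key: "norm (P x h - P x0 h) \<le> E x * norm (P x h)" if "x \<in> S" for x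
  proof -
    have "P x h - P x0 h = P x0 (A x0 (P x h) - A x (P x h))"
      using AP PA that assms(2) linear_diff[OF P] by metis
    also have "\<dots> = (\<Sum>b\<in>Basis. (P x h \<bullet> b) *\<^sub>R P x0 (A x0 b - A x b))"
      by (rule linear_eq_sum_Basis[of "\<lambda>y. P x0 (A x0 y - A x y)"])
         (rule linear_compose[OF linear_compose_sub[OF A A] P, unfolded o_def]; fact)
    also have "norm \<dots> \<le> (\<Sum>b\<in>Basis. norm (P x h) * norm (P x0 (A x0 b - A x b)))"
      by (intro sum_norm_le) (auto intro!: mult_right_mono Basis_le_norm)
    finally show ?thesis by (simp add: E_def sum_distrib_left mult.commute)
  qed
  have "\<forall>\<^sub>F x in at x0. norm (P x h - P x0 h) \<le> E x * (2 * norm (P x0 h))"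
  proof -
    \<comment> \<open>Below 1/2 the right-hand side of \<open>key\<close> can be absorbed, which
      bounds \<open>P x h\<close> near \<open>x0\<close> before its continuity is known.\<close>
    have "\<forall>\<^sub>F x in at x0. E x < 1/2" using order_tendstoD(2)[OF E0, of "1/2"] by simp
    moreover have "\<forall>\<^sub>F x in at x0. x \<in> S" using assms(1,2) by (simp add: eventually_at_in_open')
    ultimately show ?thesis
    proof eventually_elim
      case (elim x)
      have E: "0 \<le> E x" by (simp add: E_def sum_nonneg)
      have "norm (P x h) \<le> norm (P x h - P x0 h) + norm (P x0 h)" by norm
      also have "norm (P x h - P x0 h) \<le> 1/2 * norm (P x h)"
        using key[OF elim(2)] elim(1) mult_right_mono[of "E x" "1/2" "norm (P x h)"] by simp
      finally have "norm (P x h) \<le> 2 * norm (P x0 h)" by simp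
      with key[OF elim(2)] E show ?case by (meson mult_left_mono order_trans)
    qed
  qed
  then have "((\<lambda>x. P x h - P x0 h) \<longlongrightarrow> 0) (at x0)"
    by (rule Lim_null_comparison) (use tendsto_mult_left_zero[OF E0] in simp)
  then show ?thesis by (simp add: isCont_def LIM_zero_iff)
qed

text \<open>The resolvent identity, read as a first order expansion, yields the derivative - P A' P
  applied to \<open>h\<close>, which \<open>P'\<close> writes in coordinates. The coefficients
  \<open>P x h \<bullet> b\<close> are so far only continuous, but they multiply terms vanishing at
  \<open>x0\<close>. Each further order follows because \<open>P'\<close> is built from
  \<open>P\<close> and derivatives of \<open>A\<close>.\<close>

lemma Ck_on_linear_inverse:
  fixes A P :: "'a::euclidean_space \<Rightarrow> 'b::euclidean_space \<Rightarrow> 'b"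
  assumes S: "open S"
    and A: "\<And>x. x \<in> S \<Longrightarrow> linear (A x)" and P: "\<And>x. x \<in> S \<Longrightarrow> linear (P x)"
    and AP: "\<And>x h. x \<in> S \<Longrightarrow> A x (P x h) = h" and PA: "\<And>x h. x \<in> S \<Longrightarrow> P x (A x h) = h"
    and "\<And>b. Ck_on k S (\<lambda>x. A x b)"
  shows "Ck_on k S (\<lambda>x. P x h)"
  using assms(6)
proof (induction k arbitrary: h)
  case 0
  have "isCont (\<lambda>x. A x b) x" if "x \<in> S" for x b
    using 0 S that by (simp add: continuous_on_eq_continuous_at)
  then have "isCont (\<lambda>x. P x h) x" if "x \<in> S" for x
    using that by (intro continuous_linear_inverse[OF S _ A P AP PA]) auto
  then show ?case by (simp add: continuous_at_imp_continuous_on)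
next
  case (Suc k)
  define D where "D x b k = frechet_derivative (\<lambda>x. A x b) (at x) k" for x b k
  have D: "((\<lambda>x. A x b) has_derivative D x b) (at x)" if "x \<in> S" for x b
    using Ck_on_SucD(1)[OF Suc.prems[of b] that] unfolding D_def by (simp add: eta_contract_eq)
  have Ck_P: "Ck_on k S (\<lambda>x. P x h)" for h
    by (rule Suc.IH) (rule Ck_on_Suc_imp[OF Suc.prems])
  have cP: "isCont (\<lambda>x. P x h) x" if "x \<in> S" for x
    using that D by (intro continuous_linear_inverse[OF S _ A P AP PA]) (auto intro: has_derivative_continuous)
  define P' where "P' x k = (\<Sum>b\<in>Basis. (P x h \<bullet> b) *\<^sub>R P x (- D x b k))" for x k
  have "((\<lambda>x. P x h) has_derivative P' x0) (at x0)" if x0: "x0 \<in> S" for x0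
  proof -
    have bl: "bounded_linear (P x0)" using P[OF x0] linear_conv_bounded_linear by blast
    have "((\<lambda>x. P x0 h + (\<Sum>b\<in>Basis. (P x h \<bullet> b) *\<^sub>R P x0 (A x0 b - A x b)))
        has_derivative (\<lambda>k. 0 + P' x0 k)) (at x0)"
      unfolding P'_def
    proof (intro has_derivative_add has_derivative_const has_derivative_sum has_derivative_scaleR_vanishing)
      show "((\<lambda>x. P x0 (A x0 b - A x b)) has_derivative (\<lambda>k. P x0 (- D x0 b k))) (at x0)" for b
        using bounded_linear.has_derivative[OF bl has_derivative_diff[OF has_derivative_const D[OF x0]]] by simp
    qed (use cP[OF x0] in \<open>auto intro!: continuous_intros simp: linear_0[OF P[OF x0]]\<close>)
    then have "((\<lambda>x. P x0 h + (\<Sum>b\<in>Basis. (P x h \<bullet> b) *\<^sub>R P x0 (A x0 b - A x b)))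
        has_derivative P' x0) (at x0)" by simp
    then show ?thesis
    proof (rule has_derivative_transform_within_open[OF _ S x0])
      fix x assume "x \<in> S"
      have "P x h - P x0 h = P x0 (A x0 (P x h) - A x (P x h))"
        using AP PA \<open>x \<in> S\<close> x0 linear_diff[OF P] by metis
      also have "\<dots> = (\<Sum>b\<in>Basis. (P x h \<bullet> b) *\<^sub>R P x0 (A x0 b - A x b))"
        by (rule linear_eq_sum_Basis[of "\<lambda>y. P x0 (A x0 y - A x y)"])
           (rule linear_compose[OF linear_compose_sub[OF A A] P, unfolded o_def]; fact)
      finally show "P x0 h + (\<Sum>b\<in>Basis. (P x h \<bullet> b) *\<^sub>R P x0 (A x0 b - A x b)) = P x h"
        by (simp add: algebra_simps)
    qed
  qed
  moreover have "Ck_on k S (\<lambda>x. P' x k')" for k'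
  proof -
    have "Ck_on k S (\<lambda>x. D x b k')" for b unfolding D_def by (rule Ck_on_SucD(2)[OF Suc.prems])
    from Ck_on_scaleR[OF S Ck_on_const[OF S] this, of "-1"]
    have "Ck_on k S (\<lambda>x. - D x b k')" for b by simp
    then have "Ck_on k S (\<lambda>x. P x (- D x b k'))" for b
      using Ck_on_linear_apply[OF S P Ck_P] by blast
    then show ?thesis unfolding P'_def
      by (intro Ck_on_sum Ck_on_scaleR Ck_on_inner S Ck_P Ck_on_const)
  qed
  ultimately show ?case by (intro Ck_on_SucI[OF S, where f' = P'])
qed

text \<open>Bootstrapping: if \<open>g\<close> is of class k, so is the map y \<mapsto>
  \<open>D (g y)\<close>, hence so is its pointwise inverse; this inverse is the derivative of
  \<open>g\<close>, so \<open>g\<close> is of class k + 1. Injectivity of the derivative suffices as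
  domain and codomain have the same dimension.\<close>

lemma smooth_inverse_function:
  fixes f :: "'a::euclidean_space \<Rightarrow> 'a"
  assumes f: "smooth_on_open U f" and "x0 \<in> U"
    and inj: "\<And>h. frechet_derivative f (at x0) h = 0 \<Longrightarrow> h = 0"
  obtains U' V g where "open U'" "U' \<subseteq> U" "x0 \<in> U'" "f x0 \<in> V" "homeomorphism U' V f g"
    "smooth_on_open V g"
proof -
  have "open U" and Ck: "\<And>k. Ck_on k U f" using f by (auto simp: smooth_on_open_def)
  define D where "D x = frechet_derivative f (at x)" for x
  have D: "(f has_derivative D x) (at x)" if "x \<in> U" for x
    unfolding D_def by (rule Ck_on_SucD(1)[OF Ck that])
  have CkD: "Ck_on k U (\<lambda>x. D x h)" for k h unfolding D_def by (rule Ck_on_SucD(2)[OF Ck])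
  define f' where "f' x = Blinfun (D x)" for x
  have f': "blinfun_apply (f' x) = D x" if "x \<in> U" for x
    using D[OF that] by (simp add: f'_def bounded_linear_Blinfun_apply has_derivative_bounded_linear)
  obtain L where L: "linear L" "\<And>x. L (D x0 x) = x"
    using linear_injective_left_inverse[of "D x0"] has_derivative_linear[OF D[OF assms(2)]] inj
    by (auto simp: D_def linear_injective_0 fun_eq_iff)
  have "Blinfun L o\<^sub>L f' x0 = id_blinfun"
    using L f'[OF assms(2)]
    by (intro blinfun_eqI) (simp add: bounded_linear_Blinfun_apply linear_conv_bounded_linear)
  moreover have "continuous_on U f'"
    using CkD[of 0] f' by (intro continuous_on_blinfun_componentwise) (simp cong: continuous_on_cong)
  ultimately obtain U' V g g' where *: "open U'" "U' \<subseteq> U" "x0 \<in> U'" "open V" "f x0 \<in> V"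
      "homeomorphism U' V f g"
      "\<And>y. y \<in> V \<Longrightarrow> (g has_derivative (g' y)) (at y)"
      "\<And>y. y \<in> V \<Longrightarrow> g' y = inv (blinfun_apply (f'(g y)))"
      "\<And>y. y \<in> V \<Longrightarrow> bij (blinfun_apply (f'(g y)))"
    using inverse_function_theorem[OF \<open>open U\<close>, of f f' x0 "Blinfun L"] D f' \<open>x0 \<in> U\<close> by metis
  have gU: "g ` V \<subseteq> U" using * by (auto simp: homeomorphism_def)
  have "Ck_on k V g" for k
  proof (induction k)
    case 0
    then show ?case using *(6) by (simp add: homeomorphism_def)
  next
    case (Suc k)
    have "Ck_on k V (\<lambda>y. g' y h)" for h
    proof (rule Ck_on_linear_inverse[OF \<open>open V\<close>, where A = "\<lambda>y. D (g y)"])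
      show "Ck_on k V (\<lambda>y. D (g y) b)" for b
        by (rule Ck_on_compose[OF \<open>open V\<close> \<open>open U\<close> gU Suc.IH CkD])
      fix y assume y: "y \<in> V"
      then have "g y \<in> U" using gU by auto
      show "linear (D (g y))" using D[OF \<open>g y \<in> U\<close>] has_derivative_linear by blast
      show "linear (g' y)" using *(7)[OF y] has_derivative_linear by blast
      show "D (g y) (g' y h) = h" "g' y (D (g y) h) = h" for h
        using *(8,9)[OF y] f'[OF \<open>g y \<in> U\<close>]
        by (simp_all add: bij_is_surj surj_f_inv_f bij_is_inj inv_f_f)
    qed
    then show ?case by (intro Ck_on_SucI[OF \<open>open V\<close> *(7)])
  qed
  with * show ?thesis by (intro that[of U' V g]) (auto simp: smooth_on_open_def)
qed

section \<open>Matrices\<close>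

lemma bounded_bilinear_matrix_mult:
  "bounded_bilinear ((**) :: real^'b^'a \<Rightarrow> real^'c^'b \<Rightarrow> real^'c^'a)"
  unfolding bilinear_conv_bounded_bilinear[symmetric] bilinear_def linear_iff
  by (auto simp: matrix_matrix_mult_def vec_eq_iff sum.distrib algebra_simps sum_distrib_left)

lemma bounded_bilinear_matrix_vector_mult:
  "bounded_bilinear ((*v) :: real^'b^'a \<Rightarrow> real^'b \<Rightarrow> real^'a)"
  unfolding bilinear_conv_bounded_bilinear[symmetric] bilinear_def linear_iff
  by (auto simp: matrix_vector_mult_def vec_eq_iff sum.distrib algebra_simps sum_distrib_left)

interpretation mm: bounded_bilinear "(**) :: real^'b^'a \<Rightarrow> real^'c^'b \<Rightarrow> real^'c^'a"
  by (rule bounded_bilinear_matrix_mult)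

lemma linear_transpose: "linear (transpose :: real^'b^'a \<Rightarrow> real^'a^'b)"
  by (auto simp: linear_iff transpose_def vec_eq_iff)

lemma linear_column: "linear (column j :: real^'b^'a \<Rightarrow> real^'a)"
  by (auto simp: linear_iff column_def vec_eq_iff)

lemmas transpose_add = linear_add[OF linear_transpose]
lemmas Ck_on_matrix_mult = Ck_on_bilinear[OF bounded_bilinear_matrix_mult]

lemma Ck_on_transpose:
  fixes f :: "'a::euclidean_space \<Rightarrow> real^'b^'c"
  shows "open S \<Longrightarrow> Ck_on k S f \<Longrightarrow> Ck_on k S (\<lambda>x. transpose (f x))"
  by (rule Ck_on_compose[OF _ open_UNIV _ _ Ck_on_linear[OF linear_transpose]]) auto

lemma Ck_on_vec:
  fixes f :: "'a::euclidean_space \<Rightarrow> 'b::euclidean_space ^ 'n"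
  assumes "open S" "\<And>i. Ck_on k S (\<lambda>x. f x $ i)"
  shows "Ck_on k S f"
proof (rule Ck_on_cong[OF assms(1)])
  have "linear (axis i :: 'b \<Rightarrow> 'b ^ 'n)" for i
    by (auto simp: linear_iff axis_def vec_eq_iff)
  then have "Ck_on k S (\<lambda>x. axis i (f x $ i) :: 'b ^ 'n)" for i
    using Ck_on_compose[OF assms(1) open_UNIV _ assms(2) Ck_on_linear[of "axis i"]] by simp
  then show "Ck_on k S (\<lambda>x. \<Sum>i\<in>UNIV. axis i (f x $ i))"
    by (intro Ck_on_sum assms(1))
qed (simp add: vec_eq_iff axis_def sum.If_cases)

text \<open>The factor is written as a power of \<open>f x \<bullet> f x\<close>, which stays in the
  open half line where powers are smooth.\<close>

lemma Ck_on_normalize: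
  fixes f :: "'a::euclidean_space \<Rightarrow> 'b::euclidean_space"
  assumes "open S" "Ck_on k S f" "\<And>x. x \<in> S \<Longrightarrow> f x \<noteq> 0"
  shows "Ck_on k S (\<lambda>x. f x /\<^sub>R norm (f x))"
proof (rule Ck_on_cong[OF assms(1)])
  have "Ck_on k S (\<lambda>x. (f x \<bullet> f x) powr (- 1 / 2))"
    by (rule Ck_on_compose[OF assms(1) open_greaterThan _ Ck_on_inner[OF assms(1,2,2)] Ck_on_powr])
       (use assms(3) in auto)
  then show "Ck_on k S (\<lambda>x. (f x \<bullet> f x) powr (- 1 / 2) *\<^sub>R f x)"
    by (rule Ck_on_scaleR[OF assms(1) _ assms(2)])
  show "(f x \<bullet> f x) powr (- 1 / 2) *\<^sub>R f x = f x /\<^sub>R norm (f x)" if "x \<in> S" for x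
    using powr_minus[of "f x \<bullet> f x" "1 / 2"] by (simp add: powr_half_sqrt norm_eq_sqrt_inner)
qed

section \<open>Column spaces, positive definite and full rank matrices\<close>

lemma inner_matrix_vector: "x \<bullet> (A *v y) = (transpose A *v x) \<bullet> (y :: real^'q)"
  by (metis dot_lmul_matrix transpose_matrix_vector)

lemma span_columns: "span (columns (A :: real^'q^'n)) = range ((*v) A)"
proof
  have "A *v x \<in> span (columns A)" for x
    unfolding matrix_mult_sum scalar_mult_eq_scaleR
    by (intro span_sum span_scale span_base) (auto simp: columns_def)
  then show "range ((*v) A) \<subseteq> span (columns A)" by auto
  have "subspace (range ((*v) A))"
    by (intro linear_subspace_image subspace_UNIV matrix_vector_mul_linear)
  moreover have "columns A \<subseteq> range ((*v) A)"
    by (auto simp: columns_def intro: range_eqI matrix_vector_mult_basis[symmetric])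
  ultimately show "span (columns A) \<subseteq> range ((*v) A)" by (rule span_minimal[rotated])
qed

text \<open>Symmetry is left out so that these matrices form an open subset of all square
  matrices.\<close>

definition posdef :: "real^'q^'q \<Rightarrow> bool" where
  "posdef M \<longleftrightarrow> (\<forall>x. x \<noteq> 0 \<longrightarrow> 0 < x \<bullet> (M *v x))"

lemma posdef_ker: "posdef M \<Longrightarrow> M *v x = 0 \<Longrightarrow> x = 0"
  unfolding posdef_def by fastforce

lemma posdef_invertible: "posdef M \<Longrightarrow> invertible M"
  unfolding invertible_left_inverse matrix_left_invertible_ker using posdef_ker by blast

text \<open>On the compact unit sphere the quadratic form attains a positive minimum
  \<open>c\<close>. With \<open>K\<close> the constant of the bilinear bound, a perturbation of norm
  below \<open>c / K\<close> changes the form there by less than \<open>c\<close>; scaling extends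
  this to all vectors.\<close>

lemma open_posdef: "open {M :: real^'q^'q. posdef M}"
proof (rule openI)
  fix M :: "real^'q^'q" assume "M \<in> {M. posdef M}"
  then have M: "posdef M" by simp
  have "continuous_on (sphere 0 1) (\<lambda>x. x \<bullet> (M *v x))"
    by (intro continuous_intros linear_continuous_on_compose matrix_vector_mul_linear)
  then have "\<exists>x\<in>sphere 0 1. \<forall>y\<in>sphere 0 1. x \<bullet> (M *v x) \<le> y \<bullet> (M *v y)"
    by (intro continuous_attains_inf) auto
  then obtain x0 where x0: "x0 \<in> sphere 0 1" "\<And>x. x \<in> sphere 0 1 \<Longrightarrow> x0 \<bullet> (M *v x0) \<le> x \<bullet> (M *v x)"
    by blast
  define c where "c = x0 \<bullet> (M *v x0)"
  have c: "c > 0" using M x0(1) unfolding posdef_def c_def by (metis mem_sphere_0 norm_zero zero_neq_one)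
  obtain K where K: "K > 0" "\<And>(A :: real^'q^'q) x. norm (A *v x) \<le> norm A * norm x * K"
    using bounded_bilinear.pos_bounded[OF bounded_bilinear_matrix_vector_mult] by blast
  have "posdef N" if N: "dist N M < c / K" for N
    unfolding posdef_def
  proof (intro allI impI)
    fix x :: "real^'q" assume "x \<noteq> 0"
    define y where "y = x /\<^sub>R norm x"
    have y: "norm y = 1" "x = norm x *\<^sub>R y" using \<open>x \<noteq> 0\<close> by (auto simp: y_def)
    have "\<bar>y \<bullet> ((M - N) *v y)\<bar> \<le> norm (M - N) * K"
      using Cauchy_Schwarz_ineq2[of y "(M - N) *v y"] K(2)[of "M - N" y] y(1) by simp
    also have "\<dots> < c" using N K(1) by (simp add: dist_norm norm_minus_commute field_simps)
    finally have "0 < y \<bullet> (N *v y)" using x0(2)[of y] y(1)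
      by (simp add: c_def matrix_vector_mult_diff_rdistrib inner_diff_right)
    then have "0 < norm x * (norm x * (y \<bullet> (N *v y)))" using \<open>x \<noteq> 0\<close> by simp
    then show "0 < x \<bullet> (N *v x)" by (subst (1 2) y(2)) (simp add: matrix_vector_mult_scaleR)
  qed
  then show "\<exists>e>0. ball M e \<subseteq> {M. posdef M}"
    using c K(1) by (intro exI[of _ "c / K"]) (auto simp: dist_commute)
qed

text \<open>Phrased by the Gram matrix so that openness is inherited from
  \<open>open_posdef\<close>; \<open>full_rank_iff\<close> gives the usual kernel condition.\<close>

definition full_rank :: "(real^'q^'n) set" where
  "full_rank = {A. posdef (transpose A ** A)}"

lemma inner_gram: "x \<bullet> ((transpose A ** A) *v x) = (norm (A *v (x :: real^'q)))\<^sup>2"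
  by (simp add: matrix_vector_mul_assoc[symmetric] inner_matrix_vector power2_norm_eq_inner inner_commute)

lemma full_rank_iff: "A \<in> full_rank \<longleftrightarrow> (\<forall>x. A *v x = 0 \<longrightarrow> x = 0)"
  by (auto simp: full_rank_def posdef_def inner_gram)

lemma Ck_on_gram: "open S \<Longrightarrow> Ck_on k S f \<Longrightarrow> Ck_on k S (\<lambda>x. transpose (f x) ** (f x :: real^'q^'n))"
  by (intro Ck_on_matrix_mult Ck_on_transpose)

lemma Ck_on_id: "open S \<Longrightarrow> Ck_on k S (\<lambda>x. x)"
  by (rule Ck_on_bounded_linear[OF bounded_linear_ident])

lemma open_full_rank: "open (full_rank :: (real^'q^'n) set)"
proof -
  have "continuous_on UNIV (\<lambda>A :: real^'q^'n. transpose A ** A)"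
    using Ck_on_gram[OF open_UNIV Ck_on_id[OF open_UNIV], of 0] by simp
  from open_vimage[OF open_posdef this] show ?thesis by (simp add: full_rank_def vimage_def)
qed

text \<open>The kernel of \<open>R\<close> lies in that of \<open>A\<close>, so the square matrix
  \<open>R\<close> is invertible and \<open>Q\<close> is \<open>A\<close> times its inverse.\<close>

lemma full_rank_factor:
  fixes A Q :: "real^'q^'n"
  assumes "A \<in> full_rank" "A = Q ** R"
  shows "invertible R" "span (columns Q) = span (columns A)"
proof -
  show R: "invertible R"
    unfolding invertible_left_inverse matrix_left_invertible_ker
    using assms by (auto simp: full_rank_iff matrix_vector_mul_assoc[symmetric])
  then obtain S where "R ** S = mat 1" using invertible_def by blast
  then have "A ** S = Q" by (simp add: assms(2) matrix_mul_assoc[symmetric])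
  with assms(2) have "range ((*v) Q) = range ((*v) A)"
    by (auto simp: matrix_vector_mul_assoc[symmetric]) (metis matrix_vector_mul_assoc rangeI)
  then show "span (columns Q) = span (columns A)" by (simp add: span_columns)
qed

lemma stiefel_column: 
  "Q \<in> stiefel \<longleftrightarrow> (\<forall>i j. column i Q \<bullet> column j Q = (if i = j then 1 else 0))"
  by (simp add: stiefel_def matrix_mult_transpose_dot_column vec_eq_iff mat_def)

lemma column_matrix_mult: "column j (A ** B) = (\<Sum>i\<in>UNIV. B $ i $ j *\<^sub>R column i (A :: real^'q^'n))"
  by (simp add: column_def matrix_matrix_mult_def vec_eq_iff mult.commute)

lemma matrix_eq_columns: "(\<And>j. column j A = column j B) \<Longrightarrow> A = B"
  by (simp add: column_def vec_eq_iff)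

section \<open>QR decomposition\<close>

text \<open>The recursion descends along the number of predecessors of \<open>j\<close>. A zero
  residual gives the value 0, so \<open>column_gs\<close> holds without a rank condition.\<close>

function gs :: "real ^ ('q::{finite,linorder}) ^ 'n \<Rightarrow> 'q \<Rightarrow> real ^ 'n" where
  "gs A j = (let w = column j A - (\<Sum>i\<in>{..<j}. (column j A \<bullet> gs A i) *\<^sub>R gs A i) in w /\<^sub>R norm w)"
  by auto
termination
  by (relation "Wellfounded.measure (\<lambda>(A, j). card {..<j})") (auto intro!: psubset_card_mono)

declare gs.simps [simp del]

lemma finite_linorder_induct:
  fixes j :: "'q::{finite,linorder}"
  assumes "\<And>j. (\<And>i. i < j \<Longrightarrow> P i) \<Longrightarrow> P j"
  shows "P j"
proof (induction j rule: measure_induct_rule[of "\<lambda>j. card {..<j}"])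
  case (less j)
  show ?case by (rule assms) (auto intro!: less.IH psubset_card_mono)
qed

definition gs_residual :: "real ^ ('q::{finite,linorder}) ^ 'n \<Rightarrow> 'q \<Rightarrow> real ^ 'n" where
  "gs_residual A j = column j A - (\<Sum>i\<in>{..<j}. (column j A \<bullet> gs A i) *\<^sub>R gs A i)"

lemma gs_eq: "gs A j = gs_residual A j /\<^sub>R norm (gs_residual A j)"
  by (subst gs.simps) (simp add: gs_residual_def Let_def)

text \<open>The coordinate \<open>y $ j = 1\<close> makes \<open>y\<close> nonzero, so for full rank
  the residual \<open>A *v y\<close> cannot vanish.\<close>

lemma gs_residual_combination: "\<exists>y. gs_residual A j = A *v y \<and> y $ j = 1 \<and> (\<forall>k>j. y $ k = 0)"
proof -
  \<comment> \<open>Normalising destroys the coordinate 1, so the induction runs on the weaker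
    statement about \<open>gs\<close>, and \<open>res\<close> passes from it back to the
    residual.\<close>
  have res: "\<exists>y. gs_residual A j = A *v y \<and> y $ j = 1 \<and> (\<forall>k>j. y $ k = 0)"
    if IH: "\<And>i. i < j \<Longrightarrow> \<exists>y. gs A i = A *v y \<and> (\<forall>k>i. y $ k = 0)" for j
  proof -
    obtain y where y: "\<And>i. i < j \<Longrightarrow> gs A i = A *v y i" "\<And>i k. i < j \<Longrightarrow> i < k \<Longrightarrow> y i $ k = 0"
      using IH by metis
    let ?y = "axis j 1 - (\<Sum>i\<in>{..<j}. (column j A \<bullet> gs A i) *\<^sub>R y i)"
    have "gs_residual A j = A *v ?y"
      by (simp add: gs_residual_def y(1) matrix_vector_mult_diff_distrib matrix_vector_mult_basis
          linear_sum[OF matrix_vector_mul_linear] matrix_vector_mult_scaleR)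
    moreover have "?y $ j = 1" using y(2) by (simp add: sum_component)
    moreover have "?y $ k = 0" if "k > j" for k
      using y(2) that by (auto simp: sum_component axis_def intro!: sum.neutral)
    ultimately show ?thesis by blast
  qed
  have *: "\<exists>y. gs A j = A *v y \<and> (\<forall>k>j. y $ k = 0)" for j
  proof (induction j rule: finite_linorder_induct)
    case (1 j)
    obtain y where "gs_residual A j = A *v y" "\<forall>k>j. y $ k = 0" using res[OF 1] by blast
    then show ?case
      by (intro exI[of _ "y /\<^sub>R norm (gs_residual A j)"]) (simp add: gs_eq matrix_vector_mult_scaleR)
  qed
  show ?thesis by (rule res[OF *])
qed

lemma gs_residual_nz: "A \<in> full_rank \<Longrightarrow> gs_residual A j \<noteq> 0"
  using gs_residual_combination[of A j] by (metis full_rank_iff zero_index zero_neq_one)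

lemma column_gs: 
  "column j A = norm (gs_residual A j) *\<^sub>R gs A j + (\<Sum>i\<in>{..<j}. (column j A \<bullet> gs A i) *\<^sub>R gs A i)"
  by (cases "gs_residual A j = 0") (simp_all add: gs_eq[of A j], simp_all add: gs_residual_def)

lemma gs_orthonormal:
  assumes "A \<in> full_rank"
  shows "gs A i \<bullet> gs A j = (if i = j then 1 else 0)"
proof -
  have n: "gs A j \<bullet> gs A j = 1" for j
    using gs_residual_nz[OF assms, of j] 
    by (simp add: gs_eq[of A j] dot_square_norm power2_eq_square)
  have "\<forall>i<j. gs A i \<bullet> gs A j = 0" for j
  proof (induction j rule: finite_linorder_induct)
    case (1 j)
    have *: "gs A i \<bullet> gs A k = (if k = i then 1 else 0)" if "i < j" "k < j" for i k
      using 1[OF that(1)] 1[OF that(2)] n[of i] that by (metis inner_commute neqE)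
    show ?case
    proof (intro allI impI)
      fix i assume "i < j"
      then have "gs A i \<bullet> gs_residual A j = 0"
        by (simp add: gs_residual_def inner_diff_right inner_sum_right * if_distrib sum.If_cases
            inner_commute[of "gs A i" "column j A"] cong: if_cong)
      then show "gs A i \<bullet> gs A j = 0" by (simp add: gs_eq[of A j])
    qed
  qed
  with n show ?thesis by (metis inner_commute neqE)
qed

definition gs_matrix :: "real ^ ('q::{finite,linorder}) ^ 'n \<Rightarrow> real ^ ('q::{finite,linorder}) ^ 'n" where
  "gs_matrix A = (\<chi> i j. gs A j $ i)"

lemma column_gs_matrix [simp]: "column j (gs_matrix A) = gs A j"
  by (simp add: gs_matrix_def column_def)

lemma Ck_on_gs:
  "Ck_on k (full_rank :: (real ^ ('q::{finite,linorder}) ^ 'n) set) (\<lambda>A. gs A j)" (is "Ck_on k ?F _")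
proof (induction j rule: finite_linorder_induct)
  case (1 j)
  have col: "Ck_on k ?F (column j)" by (rule Ck_on_linear[OF linear_column open_full_rank])
  have "Ck_on k ?F (\<lambda>A. column j A + (\<Sum>i\<in>{..<j}. (- 1) *\<^sub>R (column j A \<bullet> gs A i) *\<^sub>R gs A i))"
    by (intro Ck_on_add Ck_on_sum Ck_on_scaleR[OF open_full_rank] Ck_on_inner Ck_on_const open_full_rank col 1) auto
  then have "Ck_on k ?F (\<lambda>A. gs_residual A j)"
    by (simp add: gs_residual_def sum_negf)
  then show ?case unfolding gs_eq
    by (intro Ck_on_normalize open_full_rank gs_residual_nz)
qed

lemma Ck_on_gs_matrix: "Ck_on k full_rank gs_matrix"
  unfolding gs_matrix_def
  by (intro Ck_on_vec open_full_rank)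
     (auto intro!: Ck_on_compose[OF open_full_rank open_UNIV _ Ck_on_gs Ck_on_bounded_linear[OF bounded_linear_vec_nth open_UNIV]])

text \<open>Orthonormality forces \<open>R $ i $ j\<close> to be the inner product of column j of
  \<open>A\<close> with column i of \<open>Q\<close>. Once the earlier columns agree, the residual
  is \<open>R $ j $ j\<close> times column j of \<open>Q\<close>, and normalising removes this
  positive factor.\<close>

lemma QR_unique:
  assumes "Q \<in> stiefel" "upper_triangular R" "\<forall>i. 0 < R $ i $ i" "A = Q ** R"
  shows "Q = gs_matrix A"
proof (rule matrix_eq_columns, simp)
  fix j
  show "column j Q = gs A j"
  proof (induction j rule: finite_linorder_induct)
    case (1 j)
    have on: "column i Q \<bullet> column k Q = (if i = k then 1 else 0)" for i k
      using assms(1) stiefel_column by blast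
    have a: "column j A = (\<Sum>i\<in>UNIV. R $ i $ j *\<^sub>R column i Q)"
      by (simp add: assms(4) column_matrix_mult)
    have ai: "column j A \<bullet> column i Q = R $ i $ j" for i
      by (simp add: a inner_sum_left on if_distrib cong: if_cong)
    have "column j A = (\<Sum>i\<in>{..j}. R $ i $ j *\<^sub>R column i Q)"
      unfolding a using assms(2) 
      by (intro sum.mono_neutral_right) (auto simp: upper_triangular_def)
    also have "{..j} = insert j {..<j}" by auto
    finally have aj: "column j A = R $ j $ j *\<^sub>R column j Q + (\<Sum>i\<in>{..<j}. R $ i $ j *\<^sub>R column i Q)" by simp
    have "(\<Sum>i\<in>{..<j}. (column j A \<bullet> gs A i) *\<^sub>R gs A i) = (\<Sum>i\<in>{..<j}. R $ i $ j *\<^sub>R column i Q)"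
      by (intro sum.cong) (simp_all add: 1[symmetric] ai)
    then have "gs_residual A j = R $ j $ j *\<^sub>R column j Q"
      by (simp only: gs_residual_def) (simp add: aj)
    moreover have "norm (column j Q) = 1" using on[of j j] by (simp add: norm_eq_1)
    ultimately show ?case using assms(3)[THEN spec, of j] by (simp add: gs_eq)
  qed
qed

lemma gs_matrix_QR:
  fixes A :: "real ^ ('q::{finite,linorder}) ^ 'n"
  assumes "A \<in> full_rank"
  shows "gs_matrix A \<in> stiefel"
    and "\<exists>R. upper_triangular R \<and> (\<forall>i. 0 < R $ i $ i) \<and> A = gs_matrix A ** R"
proof -
  show "gs_matrix A \<in> stiefel" by (simp add: stiefel_column gs_orthonormal[OF assms])
  define R :: "real ^ ('q::{finite,linorder}) ^ ('q::{finite,linorder})" where "R = (\<chi> i j. if i < j then column j A \<bullet> gs A i else if i = j then norm (gs_residual A j) else 0)"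
  have "column j A = column j (gs_matrix A ** R)" for j
  proof -
    have "column j (gs_matrix A ** R) = (\<Sum>i\<in>{..j}. R $ i $ j *\<^sub>R gs A i)"
      unfolding column_matrix_mult by (intro sum.mono_neutral_cong_right) (auto simp: R_def)
    also have "{..j} = insert j {..<j}" by auto
    also have "(\<Sum>i\<in>insert j {..<j}. R $ i $ j *\<^sub>R gs A i) = column j A"
      by (subst column_gs) (simp add: R_def)
    finally show ?thesis ..
  qed
  then have "A = gs_matrix A ** R" by (rule matrix_eq_columns)
  moreover have "upper_triangular R" by (auto simp: upper_triangular_def R_def)
  moreover have "\<forall>i. 0 < R $ i $ i" using gs_residual_nz[OF assms] by (simp add: R_def)
  ultimately show "\<exists>R. upper_triangular R \<and> (\<forall>i. 0 < R $ i $ i) \<and> A = gs_matrix A ** R" by blast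
qed

lemma qf_eq_gs_matrix:
  assumes "A \<in> full_rank"
  shows "qf A = gs_matrix A"
  unfolding qf_def using gs_matrix_QR[OF assms] QR_unique by (intro the_equality) blast+

section \<open>The tangent spaces of the Stiefel manifold\<close>

lemma has_vector_derivative_matrix_mult:
  fixes f :: "real \<Rightarrow> real^'b^'a" and g :: "real \<Rightarrow> real^'c^'b"
  shows "(f has_vector_derivative f') (at x) \<Longrightarrow> (g has_vector_derivative g') (at x) \<Longrightarrow>
    ((\<lambda>t. f t ** g t) has_vector_derivative f x ** g' + f' ** g x) (at x)"
  by (rule mm.has_vector_derivative)

lemma has_vector_derivative_transpose:
  fixes f :: "real \<Rightarrow> real^'b^'a"
  shows "(f has_vector_derivative f') (at x) \<Longrightarrow>
    ((\<lambda>t. transpose (f t)) has_vector_derivative transpose f') (at x)"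
  using bounded_linear.has_vector_derivative linear_transpose linear_conv_bounded_linear by blast

lemma smooth_on_open_differentiable:
  "smooth_on_open U f \<Longrightarrow> x \<in> U \<Longrightarrow> f differentiable (at x)"
  unfolding smooth_on_open_def by (metis Ck_on.simps(2))

text \<open>The chain rule is applied to a local smooth extension of \<open>f\<close>, which agrees
  with \<open>f\<close> along the curve. Existence of the velocity is all that is needed here; its
  value comes from \<open>retraction_curve_velocity\<close>.\<close>

lemma smooth_map_on_curve:
  assumes "smooth_map_on D f" "c differentiable (at t0)" "\<And>t. c t \<in> D"
  shows "(\<lambda>t. f (c t)) differentiable (at (t0 :: real))"
proof -
  have "\<exists>U g. c t0 \<in> U \<and> smooth_on_open U g \<and> (\<forall>y\<in>D \<inter> U. g y = f y)"
    using assms(1,3) unfolding smooth_map_on_def by (rule bspec)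
  then obtain U g where U: "c t0 \<in> U" "smooth_on_open U g" "\<forall>y\<in>D \<inter> U. g y = f y"
    by (elim exE conjE)
  have "(g \<circ> c) differentiable (at t0)"
    by (intro differentiable_chain_at assms(2) smooth_on_open_differentiable[OF U(2,1)])
  then obtain d where d: "((\<lambda>t. g (c t)) has_derivative d) (at t0)"
    unfolding differentiable_def o_def by blast
  have "(c \<longlongrightarrow> c t0) (at t0)"
    using differentiable_imp_continuous_within[OF assms(2)] by (simp add: isCont_def)
  then have "\<forall>\<^sub>F t in at t0. c t \<in> U"
    using U(1,2) by (auto simp: smooth_on_open_def intro: topological_tendstoD)
  then have "\<forall>\<^sub>F t in at t0. g (c t) = f (c t)"
    by eventually_elim (simp add: U(3) assms(3))
  then have "((\<lambda>t. f (c t)) has_derivative d) (at t0)"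
    using has_derivative_transform_eventually[OF d] U(1,3) assms(3) by simp
  then show ?thesis by (auto simp: differentiable_def)
qed

lemma has_vector_derivative_const_unique:
  assumes "(f has_vector_derivative d) (at x)" "\<forall>\<^sub>F t in at x. f t = c" "f x = c"
  shows "d = 0"
proof -
  have "((\<lambda>t. c) has_vector_derivative d) (at x)"
    using assms has_derivative_transform_eventually[of f _ x UNIV "\<lambda>t. c"]
    by (simp add: has_vector_derivative_def)
  then show ?thesis using vector_derivative_unique_at has_vector_derivative_const by blast
qed

lemma stiefel_velocity_skew:
  assumes "(c has_vector_derivative W) (at 0)" "\<forall>\<^sub>F t in at 0. c t \<in> stiefel" "c 0 \<in> stiefel"
  shows "transpose (c 0) ** W + transpose W ** c 0 = 0"
  by (rule has_vector_derivative_const_unique[OF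
        has_vector_derivative_matrix_mult[OF has_vector_derivative_transpose[OF assms(1)] assms(1)], of "mat 1"])
     (use assms(2,3) in \<open>auto simp: stiefel_def\<close>)

text \<open>With \<open>R(t) = c(t)\<^sup>T (X + t V)\<close> one has \<open>R'(0) = X\<^sup>T V + W\<^sup>T X\<close>, which is skew and
  annihilated by \<open>\<phi>\<close>, hence zero; differentiating \<open>X + t V = c(t) R(t)\<close> then gives \<open>V = W\<close>.\<close>

lemma retraction_curve_velocity:
  fixes c :: "real \<Rightarrow> real^'q^'n" and \<phi> :: "real^'q^'q \<Rightarrow> 'b::real_normed_vector"
  assumes c: "(c has_vector_derivative W) (at 0)" "\<And>t. c t \<in> stiefel" "c 0 = X"
    and V: "transpose X ** V + transpose V ** X = 0"
    and fac: "\<And>t. \<exists>T. \<phi> T = 0 \<and> X + t *\<^sub>R V = c t ** T"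
    and \<phi>: "linear \<phi>" "\<And>T. \<phi> T = 0 \<Longrightarrow> transpose T = - T \<Longrightarrow> T = 0"
  shows "W = V"
proof -
  define R where "R t = transpose (c t) ** (X + t *\<^sub>R V)" for t
  have cc: "transpose (c t) ** c t = mat 1" for t using c(2) by (simp add: stiefel_def)
  have R: "\<phi> (R t) = 0" "X + t *\<^sub>R V = c t ** R t" for t
  proof -
    obtain T where T: "\<phi> T = 0" "X + t *\<^sub>R V = c t ** T" using fac by blast
    have "R t = (transpose (c t) ** c t) ** T" by (simp only: R_def T matrix_mul_assoc)
    then have "R t = T" by (simp add: cc)
    with T show "\<phi> (R t) = 0" "X + t *\<^sub>R V = c t ** R t" by simp_all
  qed
  have XX: "transpose X ** X = mat 1" using cc[of 0] c(3) by simp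
  have "R 0 = mat 1" by (simp add: R_def c(3) XX)
  have line: "((\<lambda>t. X + t *\<^sub>R V) has_vector_derivative V) (at 0)"
    by (auto intro!: derivative_eq_intros)
  define R' where "R' = transpose X ** V + transpose W ** X"
  have dR: "(R has_vector_derivative R') (at 0)"
    using has_vector_derivative_matrix_mult[OF has_vector_derivative_transpose[OF c(1)] line] c(3)
    unfolding R_def[abs_def] R'_def by simp
  have "((\<lambda>t. \<phi> (R t)) has_vector_derivative \<phi> R') (at 0)"
    using bounded_linear.has_vector_derivative[OF _ dR] \<phi>(1) linear_conv_bounded_linear by blast
  then have "\<phi> R' = 0" by (rule has_vector_derivative_const_unique) (simp_all add: R)
  moreover have "transpose R' = - R'"
  proof -
    have "transpose X ** W + transpose W ** X = 0"
      using stiefel_velocity_skew[OF c(1)] c(2)[of 0] c(2,3) by simp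
    then have "transpose X ** W = - (transpose W ** X)" "transpose V ** X = - (transpose X ** V)"
      using V by (simp_all add: eq_neg_iff_add_eq_0 add.commute)
    then show ?thesis by (simp add: R'_def transpose_add matrix_transpose_mul)
  qed
  ultimately have "R' = 0" using \<phi>(2) by blast
  have "((\<lambda>t. c t ** R t) has_vector_derivative X ** R' + W ** R 0) (at 0)"
    using has_vector_derivative_matrix_mult[OF c(1) dR] c(3) by simp
  then have "((\<lambda>t. X + t *\<^sub>R V) has_vector_derivative W) (at 0)"
    by (simp add: \<open>R' = 0\<close> \<open>R 0 = mat 1\<close> flip: R(2))
  with line show ?thesis using vector_derivative_unique_at by blast
qed

lemma stiefel_add_gram:
  assumes "X \<in> stiefel" "transpose X ** V + transpose V ** X = 0"
  shows "transpose (X + V) ** (X + V) = mat 1 + transpose V ** V"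
proof -
  have "transpose (X + V) ** (X + V) = transpose X ** X + (transpose X ** V + transpose V ** X) + transpose V ** V"
    by (simp add: transpose_add mm.add_left mm.add_right)
  with assms show ?thesis by (simp add: stiefel_def)
qed

lemma posdef_one_plus_gram: "posdef (mat 1 + transpose V ** (V :: real^'q^'n))"
  by (auto simp: posdef_def matrix_vector_mult_add_rdistrib inner_add_right inner_gram intro!: add_pos_nonneg)

lemma stiefel_add_full_rank:
  "X \<in> stiefel \<Longrightarrow> transpose X ** V + transpose V ** X = 0 \<Longrightarrow> X + V \<in> full_rank"
  by (simp add: full_rank_def stiefel_add_gram posdef_one_plus_gram)

lemma skew_scaleR:
  "transpose X ** V + transpose V ** X = 0 \<Longrightarrow> 
   transpose X ** (t *\<^sub>R V) + transpose (t *\<^sub>R V) ** X = (0 :: real^'q^'q)"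
  by (simp add: transpose_scalar mm.scaleR_left mm.scaleR_right flip: scaleR_add_right)

text \<open>A linear map whose kernel is the space of upper triangular matrices; it plays the part
  of \<open>\<phi>\<close> in \<open>retraction_curve_velocity\<close> for the QR
  decomposition.\<close>

definition lower_part :: "real ^ ('q::{finite,linorder}) ^ ('q::{finite,linorder}) \<Rightarrow> real ^ ('q::{finite,linorder}) ^ ('q::{finite,linorder})" where
  "lower_part T = (\<chi> i j. if j < i then T $ i $ j else 0)"

lemma linear_lower_part: "linear lower_part"
  by (auto simp: linear_iff lower_part_def vec_eq_iff)

lemma lower_part_eq_0: "lower_part T = 0 \<longleftrightarrow> upper_triangular T"
  by (auto simp: lower_part_def upper_triangular_def vec_eq_iff)

lemma upper_triangular_skew:
  assumes "upper_triangular T" "transpose T = - T"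
  shows "T = 0"
proof -
  have s: "T $ j $ i = - T $ i $ j" for i j
  proof -
    have "transpose T $ i $ j = (- T) $ i $ j" by (simp only: assms(2))
    then show ?thesis by (simp only: transpose_def vec_lambda_beta vector_uminus_component)
  qed
  have "T $ i $ j = 0" for i j
  proof (cases i j rule: linorder_cases)
    case less
    then have "T $ j $ i = 0" using assms(1) by (simp add: upper_triangular_def)
    with s[of j i] show ?thesis by simp
  next
    case equal
    have "T $ j $ j = - T $ j $ j" by (rule s)
    with equal show ?thesis by simp
  next
    case greater
    then show ?thesis using assms(1) by (simp add: upper_triangular_def)
  qed
  then show ?thesis by (simp add: vec_eq_iff)
qed

lemma qf_QR:
  assumes "A \<in> full_rank"
  shows "qf A \<in> stiefel" "\<exists>R. lower_part R = 0 \<and> A = qf A ** R"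
  using gs_matrix_QR[OF assms] by (auto simp: qf_eq_gs_matrix[OF assms] lower_part_eq_0)

lemma stiefel_full_rank: "X \<in> stiefel \<Longrightarrow> X \<in> full_rank"
  using stiefel_add_full_rank[of X 0] by (simp add: linear_0[OF linear_transpose])

lemma qf_stiefel: "X \<in> stiefel \<Longrightarrow> qf X = X"
  by (subst qf_eq_gs_matrix[OF stiefel_full_rank], simp, rule QR_unique[symmetric, where R = "mat 1"])
    (simp_all add: upper_triangular_def, simp_all add: mat_def)

lemma Ck_on_qf: "Ck_on k full_rank qf"
  by (rule Ck_on_cong[OF open_full_rank _ Ck_on_gs_matrix]) (simp add: qf_eq_gs_matrix)

text \<open>One inclusion differentiates c^T c = I. The other needs a curve in
  \<open>stiefel\<close> with prescribed velocity, obtained by orthonormalising the line X + t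
  V.\<close>

lemma tangent_space_stiefel:
  fixes X :: "real ^ ('q::{finite,linorder}) ^ 'n"
  assumes "X \<in> stiefel"
  shows "tangent_space stiefel X = {V. transpose X ** V + transpose V ** X = 0}"
proof (intro set_eqI iffI)
  fix V assume "V \<in> tangent_space stiefel X"
  then obtain c e where c: "0 < e" "\<forall>t\<in>{-e<..<e}. c t \<in> stiefel" "c 0 = X"
    "(c has_vector_derivative V) (at (0::real))" by (auto simp: tangent_space_def)
  have "\<forall>\<^sub>F t in at 0. t \<in> {-e<..<e}"
    using c(1) by (intro eventually_at_in_open') auto
  then have "\<forall>\<^sub>F t in at 0. c t \<in> stiefel" by eventually_elim (use c in auto)
  from stiefel_velocity_skew[OF c(4) this] c(3) assms
  show "V \<in> {V. transpose X ** V + transpose V ** X = 0}" by simp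
next
  fix V assume "V \<in> {V. transpose X ** V + transpose V ** X = 0}"
  then have V: "transpose X ** V + transpose V ** X = 0" by simp
  define c where "c t = qf (X + t *\<^sub>R V)" for t :: real
  have fr: "X + t *\<^sub>R V \<in> full_rank" for t
    by (intro stiefel_add_full_rank assms skew_scaleR V)
  have "Ck_on k UNIV (\<lambda>t :: real. X + t *\<^sub>R V)" for k
    by (intro Ck_on_add Ck_on_scaleR Ck_on_const Ck_on_id open_UNIV)
  then have Ck: "Ck_on k UNIV c" for k
    unfolding c_def[abs_def] using fr
    by (intro Ck_on_compose[OF open_UNIV open_full_rank _ _ Ck_on_qf]) auto
  have "c differentiable (at 0)" using Ck[of "Suc 0"] by simp
  then obtain W where W: "(c has_vector_derivative W) (at 0)" using vector_derivative_works by blast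
  have c0: "c 0 = X" by (simp add: c_def qf_stiefel assms)
  \<comment> \<open>Smoothness only supplied some velocity \<open>W\<close>; the triangular shape of
    the second factor determines it.\<close>
  have "W = V"
    by (rule retraction_curve_velocity[OF W _ c0 V _ linear_lower_part])
       (auto simp: c_def lower_part_eq_0 upper_triangular_skew qf_QR[OF fr, unfolded lower_part_eq_0])
  with W have "(c has_vector_derivative V) (at 0)" by simp
  moreover have "smooth_on_open {-1<..<1} c"
    using Ck by (auto simp: smooth_on_open_def intro: Ck_on_subset)
  moreover have "c t \<in> stiefel" for t unfolding c_def by (rule qf_QR(1)[OF fr])
  ultimately show "V \<in> tangent_space stiefel X"
    unfolding tangent_space_def using c0 by (intro CollectI exI[of _ c] exI[of _ 1]) auto
qed

section \<open>Retractions on the Stiefel manifold from matrix factorisations\<close>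

lemma tangent_bundle_stiefel:
  "((X :: real ^ ('q::{finite,linorder}) ^ 'n), V) \<in> tangent_bundle stiefel \<longleftrightarrow>
    X \<in> stiefel \<and> transpose X ** V + transpose V ** X = 0"
  by (auto simp: tangent_bundle_def tangent_space_stiefel)

text \<open>Common frame for both decompositions: the kernel of \<open>\<phi>\<close> is the linear
  space of admissible second factors, upper triangular or symmetric, and meets the skew matrices
  only in 0. The factorisation also preserves the span, since X + V has full rank.\<close>

lemma stiefel_retractionI:
  fixes R :: "real ^ ('q::{finite,linorder}) ^ 'n \<Rightarrow> real ^ ('q::{finite,linorder}) ^ 'n \<Rightarrow> real ^ ('q::{finite,linorder}) ^ 'n"
    and \<phi> :: "real ^ ('q::{finite,linorder}) ^ ('q::{finite,linorder}) \<Rightarrow> 'b::real_normed_vector"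
  assumes smooth: "smooth_map_on (tangent_bundle stiefel) (\<lambda>(X, V). R X V)"
    and R: "\<And>X V. X \<in> stiefel \<Longrightarrow> transpose X ** V + transpose V ** X = 0 \<Longrightarrow> R X V \<in> stiefel"
    and fac: "\<And>X V. X \<in> stiefel \<Longrightarrow> transpose X ** V + transpose V ** X = 0 \<Longrightarrow>
      \<exists>T. \<phi> T = 0 \<and> X + V = R X V ** T"
    and R0: "\<And>X. X \<in> stiefel \<Longrightarrow> R X 0 = X"
    and \<phi>: "linear \<phi>" "\<And>T. \<phi> T = 0 \<Longrightarrow> transpose T = - T \<Longrightarrow> T = 0"
  shows "manifold_retraction stiefel (tangent_bundle stiefel) R"
    and "span_preserving (tangent_bundle stiefel) R"
proof -
  have "((\<lambda>t. R X (t *\<^sub>R V)) has_vector_derivative V) (at 0)"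
    if X: "X \<in> stiefel" and V: "transpose X ** V + transpose V ** X = 0" for X V
  proof -
    have "(\<lambda>t::real. (X, t *\<^sub>R V)) differentiable (at 0)"
      unfolding differentiable_def by (auto intro!: exI derivative_eq_intros)
    from smooth_map_on_curve[OF smooth this]
    have "(\<lambda>t. R X (t *\<^sub>R V)) differentiable (at 0)"
      by (simp add: tangent_bundle_stiefel X skew_scaleR[OF V])
    then obtain W where W: "((\<lambda>t. R X (t *\<^sub>R V)) has_vector_derivative W) (at 0)"
      using vector_derivative_works by blast
    have "W = V"
      by (rule retraction_curve_velocity[OF W _ _ V _ \<phi>])
         (use X R[OF X skew_scaleR[OF V]] fac[OF X skew_scaleR[OF V]] R0 in auto)
    with W show ?thesis by simp
  qed
  then show "manifold_retraction stiefel (tangent_bundle stiefel) R"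
    unfolding manifold_retraction_def using smooth R R0
    by (auto simp: tangent_bundle_stiefel tangent_space_stiefel linear_0[OF linear_transpose])
  show "span_preserving (tangent_bundle stiefel) R"
    unfolding span_preserving_def
    using fac full_rank_factor(2)[OF stiefel_add_full_rank] by (fastforce simp: tangent_bundle_stiefel)
qed

lemma smooth_map_on_qf:
  "smooth_map_on (tangent_bundle (stiefel :: (real ^ ('q::{finite,linorder}) ^ 'n) set)) (\<lambda>(X, V). qf (X + V))"
proof -
  let ?U = "(\<lambda>p. fst p + snd p) -` (full_rank :: (real ^ ('q::{finite,linorder}) ^ 'n) set)"
  have "open ?U" by (intro open_vimage open_full_rank continuous_intros)
  moreover have "Ck_on k ?U (\<lambda>p. qf (fst p + snd p))" for k
    by (rule Ck_on_compose[OF \<open>open ?U\<close> open_full_rank _ _ Ck_on_qf])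
       (auto intro!: Ck_on_bounded_linear bounded_linear_add bounded_linear_fst bounded_linear_snd \<open>open ?U\<close>)
  ultimately have "smooth_on_open ?U (\<lambda>p. qf (fst p + snd p))"
    by (simp add: smooth_on_open_def)
  then show ?thesis unfolding smooth_map_on_def
    by (intro ballI exI[of _ ?U] exI[of _ "\<lambda>p. qf (fst p + snd p)"])
       (auto simp: tangent_bundle_stiefel stiefel_add_full_rank)
qed

lemma qf_retraction:
  "manifold_retraction (stiefel :: (real ^ ('q::{finite,linorder}) ^ 'n) set) (tangent_bundle stiefel) (\<lambda>X V. qf (X + V))"
  "span_preserving (tangent_bundle (stiefel :: (real ^ ('q::{finite,linorder}) ^ 'n) set)) (\<lambda>X V. qf (X + V))"
  by (rule stiefel_retractionI[OF smooth_map_on_qf qf_QR(1) qf_QR(2) _ linear_lower_part],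
      simp_all add: stiefel_add_full_rank qf_stiefel lower_part_eq_0 upper_triangular_skew)+

section \<open>Square roots of positive definite matrices\<close>

lemma
  fixes M :: "'a::semiring_1 ^ 'q ^ 'p"
  assumes "invertible M"
  shows matrix_inv_right: "M ** matrix_inv M = mat 1" and matrix_inv_left: "matrix_inv M ** M = mat 1"
  using someI_ex[OF assms[unfolded invertible_def]] by (simp_all add: matrix_inv_def)

text \<open>Left multiplication by \<open>f x\<close> is a linear map with inverse left
  multiplication by \<open>matrix_inv (f x)\<close>; its value at the identity matrix is the inverse
  itself.\<close>

lemma Ck_on_matrix_inv:
  fixes f :: "'a::euclidean_space \<Rightarrow> real^'q^'q"
  assumes "open S" "Ck_on k S f" "\<And>x. x \<in> S \<Longrightarrow> invertible (f x)"
  shows "Ck_on k S (\<lambda>x. matrix_inv (f x))"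
proof -
  have lin: "linear (\<lambda>H. M ** H)" for M :: "real^'q^'q"
    by (simp add: linear_iff mm.add_right mm.scaleR_right)
  have "Ck_on k S (\<lambda>x. matrix_inv (f x) ** mat 1)"
  proof (rule Ck_on_linear_inverse[OF assms(1), where A = "\<lambda>x H. f x ** H"])
    fix x and H :: "real^'q^'q" assume "x \<in> S"
    then have "f x ** matrix_inv (f x) = mat 1" "matrix_inv (f x) ** f x = mat 1"
      using assms(3) by (simp_all add: matrix_inv_right matrix_inv_left)
    then show "f x ** (matrix_inv (f x) ** H) = H" "matrix_inv (f x) ** (f x ** H) = H"
      by (simp_all only: matrix_mul_assoc matrix_mul_lid)
  qed (intro lin Ck_on_matrix_mult assms(1,2) Ck_on_const)+
  then show ?thesis by simp
qed

section \<open>The Sylvester equation and uniqueness of square roots\<close>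

lemma inner_matrix_mult_left: "H \<bullet> (B ** H) = (\<Sum>j\<in>UNIV. column j H \<bullet> (B *v column j (H :: real^'b^'a)))"
  unfolding inner_vec_def[of H]
  by (simp add: inner_vec_def matrix_matrix_mult_def matrix_vector_mult_def column_def, rule sum.swap)

lemma inner_matrix_mult_right: "H \<bullet> (H ** C) = (\<Sum>i\<in>UNIV. H $ i \<bullet> (C *v (H :: real^'b^'a) $ i))"
proof -
  have "(H ** C) $ i = transpose C *v H $ i" for i
    by (simp add: matrix_matrix_mult_def matrix_vector_mult_def transpose_def vec_eq_iff mult.commute)
  then show ?thesis by (simp add: inner_vec_def[of H] inner_matrix_vector inner_commute)
qed

text \<open>Both sides are the trace of A^T A. This bounds a symmetric root \<open>B\<close> by the
  matrix \<open>B ** B\<close>, which gives compactness in the existence proof.\<close>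

lemma inner_gram_one: "mat 1 \<bullet> (transpose A ** A) = (norm (A :: real^'q^'n))\<^sup>2"
proof -
  have "mat 1 \<bullet> M = (\<Sum>i\<in>UNIV. M $ i $ i)" for M :: "real^'q^'q"
    by (simp add: inner_vec_def mat_def if_distrib if_distribR cong: if_cong)
  then have "mat 1 \<bullet> (transpose A ** A) = (\<Sum>j\<in>UNIV. \<Sum>i\<in>UNIV. A $ i $ j * A $ i $ j)"
    by (simp add: matrix_matrix_mult_def transpose_def)
  also have "\<dots> = A \<bullet> A" by (simp add: inner_vec_def, rule sum.swap)
  finally show ?thesis by (simp add: power2_norm_eq_inner)
qed

lemma posdef_imp_nonneg: "posdef B \<Longrightarrow> 0 \<le> x \<bullet> (B *v x)"
  unfolding posdef_def by (cases "x = 0") (auto simp: less_imp_le)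

text \<open>Pairing the equation with \<open>H\<close> gives two nonnegative numbers with sum 0:
  quadratic forms of \<open>B\<close> summed over the columns of \<open>H\<close>, and of
  \<open>C\<close> over its rows. Definiteness of \<open>B\<close> then kills every column. With C =
  B this is injectivity of the derivative of squaring.\<close>

lemma sylvester_unique:
  fixes H :: "real^'q^'q"
  assumes "posdef B" "\<And>x. 0 \<le> x \<bullet> (C *v x)" "B ** H + H ** C = 0"
  shows "H = 0"
proof -
  note nn = posdef_imp_nonneg[OF assms(1)]
  have "H \<bullet> (B ** H) + H \<bullet> (H ** C) = 0"
    using assms(3) by (metis inner_add_right inner_zero_right)
  moreover have "0 \<le> H \<bullet> (B ** H)" "0 \<le> H \<bullet> (H ** C)"
    unfolding inner_matrix_mult_left inner_matrix_mult_right by (intro sum_nonneg nn assms(2))+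
  ultimately have "H \<bullet> (B ** H) = 0" by simp
  then have "\<forall>j. column j H \<bullet> (B *v column j H) = 0"
    unfolding inner_matrix_mult_left by (subst (asm) sum_nonneg_eq_0_iff) (auto simp: nn)
  then have "column j H = 0" for j
    using assms(1) unfolding posdef_def by (metis less_irrefl)
  then show ?thesis by (simp add: column_def vec_eq_iff)
qed

lemma sqrt_unique:
  fixes B C :: "real^'q^'q"
  assumes "posdef B" "\<And>x. 0 \<le> x \<bullet> (C *v x)" "B ** B = C ** C"
  shows "B = C"
proof -
  have "B ** (B - C) + (B - C) ** C = 0"
    by (simp add: mm.diff_left mm.diff_right assms(3))
  from sylvester_unique[OF assms(1,2) this] show ?thesis by simp
qed

lemma mat_sqrt_eq:
  fixes B :: "real^'q^'q"
  assumes "posdef B" "transpose B = B"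
  shows "mat_sqrt (B ** B) = B"
  unfolding mat_sqrt_def
proof (rule the_equality)
  show "transpose B = B \<and> (\<forall>x. 0 \<le> x \<bullet> (B *v x)) \<and> B ** B = B ** B"
    using assms(2) posdef_imp_nonneg[OF assms(1)] by simp
  show "C = B" if "transpose C = C \<and> (\<forall>x. 0 \<le> x \<bullet> (C *v x)) \<and> C ** C = B ** B" for C
    using sqrt_unique[OF assms(1), of C] that by simp
qed

text \<open>If the form of \<open>B\<close> vanished at \<open>x\<close>, moving from
  \<open>x\<close> in the direction -B x would make it negative. The vector B x is nonzero because B
  (B x) is.\<close>

lemma posdef_sqrt:
  fixes B :: "real^'q^'q"
  assumes "transpose B = B" "\<And>x. 0 \<le> x \<bullet> (B *v x)" "posdef (B ** B)"
  shows "posdef B"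
  unfolding posdef_def
proof (intro allI impI)
  fix x :: "real^'q" assume "x \<noteq> 0"
  have sym: "x \<bullet> (B *v y) = (B *v x) \<bullet> y" for x y by (simp only: inner_matrix_vector assms(1))
  define y where "y = B *v x"
  define a b where "a = y \<bullet> y" and "b = y \<bullet> (B *v y)"
  have "B *v y \<noteq> 0" using posdef_ker[OF assms(3), of x] \<open>x \<noteq> 0\<close>
    by (auto simp: y_def matrix_vector_mul_assoc)
  then have a: "a > 0" by (auto simp: a_def)
  have b: "b \<ge> 0" using assms(2) by (simp add: b_def)
  have "x \<bullet> (B *v x) \<noteq> 0"
  proof
    assume 0: "x \<bullet> (B *v x) = 0"
    have *: "0 \<le> - 2 * t * a + t * t * b" for t
    proof -
      have "0 \<le> (x - t *\<^sub>R y) \<bullet> (B *v (x - t *\<^sub>R y))" by (rule assms(2))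
      also have "\<dots> = x \<bullet> (B *v x) - t * (x \<bullet> (B *v y)) - t * (y \<bullet> (B *v x)) + t * t * b"
        by (simp add: matrix_vector_mult_diff_distrib matrix_vector_mult_scaleR inner_diff_left
            inner_diff_right algebra_simps b_def)
      also have "\<dots> = - 2 * t * a + t * t * b"
        unfolding sym[of x y] by (simp add: 0[folded y_def] flip: y_def a_def)
      finally show ?thesis .
    qed
    show False
    \<comment> \<open>For b = 0 the bound is a falling line in t; otherwise t = a / b minimises the
      parabola, with negative minimum - a^2 / b.\<close>
    proof (cases "b = 0")
      case True
      with *[of 1] a show False by simp
    next
      case False
      with *[of "a / b"] a b have "a * a \<le> 0" by (simp add: field_simps)
      with mult_pos_pos[OF a a] show False by linarith
    qed
  qed
  with assms(2)[of x] show "0 < x \<bullet> (B *v x)" by simp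
qed

text \<open>A local inverse of squaring at \<open>B\<close>. It is defined on possibly nonsymmetric
  matrices, so symmetry of its values is a separate conclusion.\<close>

lemma local_matrix_sqrt:
  fixes B :: "real^'q^'q"
  assumes "posdef B" "transpose B = B"
  obtains W g where "smooth_on_open W g" "B ** B \<in> W" "\<And>S. S \<in> W \<Longrightarrow> posdef (g S) \<and> g S ** g S = S"
    "\<And>S. S \<in> W \<Longrightarrow> transpose S = S \<Longrightarrow> transpose (g S) = g S"
proof -
  let ?f = "\<lambda>B :: real^'q^'q. B ** B" and ?U = "{M :: real^'q^'q. posdef M}"
  have sm: "smooth_on_open ?U ?f"
    unfolding smooth_on_open_def by (intro conjI allI Ck_on_matrix_mult open_posdef Ck_on_id)
  have "(?f has_derivative (\<lambda>H. B ** H + H ** B)) (at B)"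
    by (rule mm.FDERIV[OF has_derivative_ident has_derivative_ident])
  then have "frechet_derivative ?f (at B) = (\<lambda>H. B ** H + H ** B)"
    by (rule frechet_derivative_at[symmetric])
  then have inj: "H = 0" if "frechet_derivative ?f (at B) H = 0" for H
    using that by (intro sylvester_unique[OF assms(1) posdef_imp_nonneg[OF assms(1)], of H]) simp
  have "B \<in> ?U" using assms(1) by simp
  obtain U' V g where *: "open U'" "U' \<subseteq> ?U" "B \<in> U'" "B ** B \<in> V"
      "homeomorphism U' V ?f g" "smooth_on_open V g"
    by (rule smooth_inverse_function[OF sm \<open>B \<in> ?U\<close> inj])
  have V: "open V" "\<And>k. Ck_on k V g" using *(6) by (auto simp: smooth_on_open_def)
  have fg: "g S \<in> U'" "g S ** g S = S" if "S \<in> V" for S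
    using *(5) that by (auto simp: homeomorphism_def)
  have gf: "g (C ** C) = C" if "C \<in> U'" for C
    using *(5) that by (auto simp: homeomorphism_def)
  \<comment> \<open>For symmetric \<open>S\<close> the transpose of \<open>g S\<close> is another
    root of \<open>S\<close>. Keeping this transpose inside \<open>U'\<close>, where squaring is
    injective, forces it to equal \<open>g S\<close>.\<close>
  define W where "W = V \<inter> (\<lambda>S. transpose (g S)) -` U'"
  have "open W" unfolding W_def
    using Ck_on_transpose[OF V, of 0] by (intro continuous_open_preimage V(1) *(1)) simp
  then have "smooth_on_open W g" using V(2) by (auto simp: smooth_on_open_def W_def intro: Ck_on_subset)
  moreover have "B ** B \<in> W" using * gf assms(2) by (simp add: W_def)
  moreover have "posdef (g S) \<and> g S ** g S = S" if "S \<in> W" for S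
    using fg[of S] *(2) that by (auto simp: W_def)
  moreover have "transpose (g S) = g S" if "S \<in> W" "transpose S = S" for S
  proof -
    have "transpose (g S) ** transpose (g S) = S"
      using fg(2)[of S] that by (simp add: W_def matrix_transpose_mul[symmetric])
    then show ?thesis using gf[of "transpose (g S)"] that(1) by (simp add: W_def)
  qed
  ultimately show ?thesis by (rule that)
qed

lemma transpose_segment: "transpose (a *\<^sub>R mat 1 + b *\<^sub>R (S :: real^'q^'q)) = a *\<^sub>R mat 1 + b *\<^sub>R transpose S"
  by (simp add: transpose_add transpose_scalar)

text \<open>Continuity method: along the segment from \<open>I\<close> to \<open>S\<close> the set of parameters for which a root
  exists is open by the inverse function theorem and closed by compactness.\<close>

lemma posdef_sqrt_exists:
  fixes S :: "real^'q^'q"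
  assumes "posdef S" "transpose S = S"
  shows "\<exists>B. posdef B \<and> transpose B = B \<and> B ** B = S"
proof -
  define P where "P t = (1 - t) *\<^sub>R mat 1 + t *\<^sub>R S" for t :: real
  have posP: "posdef (P t)" if "t \<in> {0..1}" for t
    unfolding posdef_def
  proof (intro allI impI)
    fix x :: "real^'q" assume "x \<noteq> 0"
    then have "0 < x \<bullet> x" "0 < x \<bullet> (S *v x)" using assms(1) by (auto simp: posdef_def)
    moreover have "x \<bullet> (P t *v x) = (1 - t) * (x \<bullet> x) + t * (x \<bullet> (S *v x))"
      by (simp add: P_def matrix_vector_mult_add_rdistrib inner_add_right flip: scaleR_matrix_vector_assoc)
    ultimately show "0 < x \<bullet> (P t *v x)" using that
      by (cases "t = 0") (auto intro!: add_nonneg_pos)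
  qed
  have contP: "continuous_on A P" for A unfolding P_def by (intro continuous_intros)
  define T where "T = {t \<in> {0..1}. \<exists>B. posdef B \<and> transpose B = B \<and> B ** B = P t}"
  have "openin (top_of_set {0..1}) T"
  proof (subst openin_subopen, intro ballI)
    fix t assume "t \<in> T"
    then obtain B where B: "t \<in> {0..1}" "posdef B" "transpose B = B" "B ** B = P t" by (auto simp: T_def)
    obtain W g where W: "smooth_on_open W g" "B ** B \<in> W" "\<And>S. S \<in> W \<Longrightarrow> posdef (g S) \<and> g S ** g S = S"
      "\<And>S. S \<in> W \<Longrightarrow> transpose S = S \<Longrightarrow> transpose (g S) = g S"
      using local_matrix_sqrt[OF B(2,3)] by blast
    have "{0..1} \<inter> P -` W \<subseteq> T"
    proof
      fix s assume s: "s \<in> {0..1} \<inter> P -` W"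
      have "transpose (P s) = P s" by (simp add: P_def transpose_segment assms(2))
      with s W(3,4)[of "P s"] show "s \<in> T" by (auto simp: T_def)
    qed
    moreover have "openin (top_of_set {0..1}) ({0..1} \<inter> P -` W)"
      using W(1) by (intro continuous_openin_preimage_gen contP) (simp add: smooth_on_open_def)
    ultimately show "\<exists>U. openin (top_of_set {0..1}) U \<and> t \<in> U \<and> U \<subseteq> T"
      using B W(2) by (intro exI[of _ "{0..1} \<inter> P -` W"]) auto
  qed
  moreover have "closedin (top_of_set {0..1}) T"
  proof -
    \<comment> \<open>Semidefinite roots are collected because this condition is closed;
      \<open>posdef_sqrt\<close> restores definiteness as \<open>P t\<close> is positive
      definite.\<close>
    define K where "K = {p :: real \<times> (real^'q^'q). fst p \<in> {0..1} \<and> transpose (snd p) = snd p \<and>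
      (\<forall>x. 0 \<le> x \<bullet> (snd p *v x)) \<and> snd p ** snd p = P (fst p)}"
    have "T = fst ` K"
    proof (intro set_eqI iffI)
      fix t assume "t \<in> T"
      then obtain B where "t \<in> {0..1}" "posdef B" "transpose B = B" "B ** B = P t" by (auto simp: T_def)
      then have "(t, B) \<in> K" by (auto simp: K_def posdef_imp_nonneg)
      then show "t \<in> fst ` K" by force
    next
      fix t assume "t \<in> fst ` K"
      then obtain B where "t \<in> {0..1}" "transpose B = B" "\<And>x. 0 \<le> x \<bullet> (B *v x)" "B ** B = P t"
        by (auto simp: K_def)
      then show "t \<in> T" using posdef_sqrt[of B] posP[of t] by (auto simp: T_def)
    qed
    moreover have "compact K"
    proof -
      have "continuous_on UNIV (\<lambda>p :: real \<times> (real^'q^'q). transpose (snd p))"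
        using Ck_on_transpose[OF open_UNIV Ck_on_bounded_linear[OF bounded_linear_snd open_UNIV], of 0] by simp
      moreover have "continuous_on UNIV (\<lambda>p :: real \<times> (real^'q^'q). snd p *v x)" for x
        by (intro bounded_bilinear.continuous_on[OF bounded_bilinear_matrix_vector_mult] continuous_intros)
      moreover have "continuous_on UNIV (\<lambda>p :: real \<times> (real^'q^'q). snd p ** snd p)"
        by (intro bounded_bilinear.continuous_on[OF bounded_bilinear_matrix_mult] continuous_intros)
      moreover have "continuous_on UNIV (\<lambda>p :: real \<times> (real^'q^'q). P (fst p))"
        unfolding P_def by (intro continuous_intros)
      moreover have "closed {p :: real \<times> (real^'q^'q). fst p \<in> {0..1}}"
        using closed_vimage_fst[OF closed_atLeastAtMost, of 0 1] by (simp add: vimage_def)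
      ultimately have "closed K"
        unfolding K_def
        by (intro closed_Collect_conj closed_Collect_all closed_Collect_eq closed_Collect_le continuous_intros)
      moreover have "bounded K"
      proof -
        let ?I = "mat 1 :: real^'q^'q"
        have bd: "norm B \<le> 1 + norm ?I * (norm ?I + norm S)" "norm t \<le> 1" if "(t, B) \<in> K" for t B
        proof -
          have t: "t \<in> {0..1}" and B: "transpose B = B" "B ** B = P t" using that by (auto simp: K_def)
          show "norm t \<le> 1" using t by auto
          have "(norm B)\<^sup>2 = ?I \<bullet> P t" using inner_gram_one[of B] B by simp
          also have "\<dots> \<le> norm ?I * norm (P t)" by (rule norm_cauchy_schwarz)
          also have "norm (P t) \<le> norm ((1 - t) *\<^sub>R ?I) + norm (t *\<^sub>R S)" unfolding P_def by (rule norm_triangle_ineq)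
          also have "\<dots> \<le> norm ?I + norm S" using t by (auto intro!: add_mono mult_left_le_one_le)
          finally have n: "(norm B)\<^sup>2 \<le> norm ?I * (norm ?I + norm S)" by (simp add: mult_left_mono)
          \<comment> \<open>Follows from \<open>(norm B - 1)\<^sup>2 \<ge> 0\<close> and avoids
            taking a root of the bound \<open>n\<close>.\<close>
          have "norm B \<le> 1 + (norm B)\<^sup>2"
            using zero_le_power2[of "norm B - 1"] norm_ge_zero[of B] unfolding power2_diff power_one by linarith
          with n show "norm B \<le> 1 + norm ?I * (norm ?I + norm S)" by simp
        qed
        have "K \<subseteq> cball 0 1 \<times> cball 0 (1 + norm ?I * (norm ?I + norm S))"
        proof clarify
          fix t B assume "(t, B) \<in> K"
          from bd[OF this] show "t \<in> cball 0 1 \<and> B \<in> cball 0 (1 + norm ?I * (norm ?I + norm S))"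
            by (simp only: mem_cball_0)
        qed
        then show ?thesis by (rule bounded_subset[OF bounded_Times[OF bounded_cball bounded_cball]])
      qed
      ultimately show ?thesis by (simp add: compact_eq_bounded_closed)
    qed
    ultimately have "compact T" by (simp add: compact_continuous_image continuous_on_fst)
    then show ?thesis by (intro closed_subset) (auto simp: T_def compact_imp_closed)
  qed
  moreover have "0 \<in> T"
    unfolding T_def by (auto intro!: exI[of _ "mat 1"] simp: P_def posdef_def)
  ultimately have "T = {0..1}"
    using connected_clopen[of "{0..1::real}"] by (auto simp: connected_Icc)
  then have "1 \<in> T" by simp
  then show ?thesis by (simp add: T_def P_def)
qed

lemma mat_sqrt_posdef:
  fixes S :: "real^'q^'q"
  assumes "posdef S" "transpose S = S"
  shows "posdef (mat_sqrt S)" "transpose (mat_sqrt S) = mat_sqrt S" "mat_sqrt S ** mat_sqrt S = S"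
proof -
  obtain B where "posdef B" "transpose B = B" "B ** B = S" using posdef_sqrt_exists[OF assms] by blast
  with mat_sqrt_eq[of B] show "posdef (mat_sqrt S)" "transpose (mat_sqrt S) = mat_sqrt S" "mat_sqrt S ** mat_sqrt S = S"
    by simp_all
qed

section \<open>The polar retraction\<close>

lemma transpose_one_plus_gram: "transpose (mat 1 + transpose V ** V) = mat 1 + transpose V ** (V :: real^'q^'n)"
  by (simp add: transpose_add matrix_transpose_mul)

text \<open>I + V^T V is symmetric and positive definite for every V, so the local smooth root may
  replace \<open>mat_sqrt\<close> near any point of the ambient space; by uniqueness of positive
  roots the two agree.\<close>

lemma smooth_map_on_polar: "smooth_map_on A (\<lambda>(X, V). polar_retr X (V :: real^'q^'n))"
  unfolding smooth_map_on_def
proof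
  fix p assume "p \<in> A"
  let ?G = "\<lambda>p :: (real^'q^'n) \<times> (real^'q^'n). mat 1 + transpose (snd p) ** snd p"
  define B where "B = mat_sqrt (?G p)"
  have B: "posdef B" "transpose B = B" "B ** B = ?G p"
    using mat_sqrt_posdef[OF posdef_one_plus_gram transpose_one_plus_gram] by (simp_all add: B_def)
  obtain W g where W: "smooth_on_open W g" "B ** B \<in> W" "\<And>S. S \<in> W \<Longrightarrow> posdef (g S) \<and> g S ** g S = S"
      "\<And>S. S \<in> W \<Longrightarrow> transpose S = S \<Longrightarrow> transpose (g S) = g S"
    using local_matrix_sqrt[OF B(1,2)] by blast
  have W': "open W" "Ck_on k W g" for k using W(1) by (auto simp: smooth_on_open_def)
  have G: "Ck_on k S ?G" if "open S" for k S
    by (intro Ck_on_add Ck_on_gram Ck_on_const that Ck_on_bounded_linear bounded_linear_snd)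
  define U where "U = ?G -` W"
  have U: "open U" unfolding U_def using G[OF open_UNIV, of 0] by (intro open_vimage W'(1)) simp
  define h where "h p = (fst p + snd p) ** matrix_inv (g (?G p))" for p
  have "Ck_on k U (\<lambda>p. g (?G p))" for k
    by (rule Ck_on_compose[OF U W'(1) _ G[OF U] W'(2)]) (auto simp: U_def)
  then have "Ck_on k U (\<lambda>p. matrix_inv (g (?G p)))" for k
    by (rule Ck_on_matrix_inv[OF U]) (use W(3) in \<open>auto simp: U_def posdef_invertible\<close>)
  then have "Ck_on k U h" for k
    unfolding h_def[abs_def]
    by (rule Ck_on_matrix_mult[OF U Ck_on_bounded_linear[OF bounded_linear_add[OF bounded_linear_fst bounded_linear_snd] U]])
  then have "smooth_on_open U h" using U by (simp add: smooth_on_open_def)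
  moreover have "h y = (case y of (X, V) \<Rightarrow> polar_retr X V)" if "y \<in> U" for y
  proof -
    have "?G y \<in> W" using that by (simp add: U_def)
    then have "mat_sqrt (?G y) = g (?G y)"
      using mat_sqrt_eq[of "g (?G y)"] W(3,4)[of "?G y"] by (simp add: transpose_one_plus_gram)
    then show ?thesis by (simp add: h_def polar_retr_def case_prod_unfold)
  qed
  moreover have "p \<in> U" using W(2) B(3) by (simp add: U_def)
  ultimately show "\<exists>U h. p \<in> U \<and> smooth_on_open U h \<and> (\<forall>y\<in>A \<inter> U. h y = (case y of (X, V) \<Rightarrow> polar_retr X V))"
    by blast
qed

lemma polar_retr_factor:
  fixes X V :: "real^'q^'n"
  assumes "X \<in> stiefel" "transpose X ** V + transpose V ** X = 0"
  shows "polar_retr X V \<in> stiefel" "\<exists>B. transpose B - B = 0 \<and> X + V = polar_retr X V ** B"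
proof -
  define B where "B = mat_sqrt (mat 1 + transpose V ** V)"
  have B: "posdef B" "transpose B = B" "B ** B = mat 1 + transpose V ** V"
    using mat_sqrt_posdef[OF posdef_one_plus_gram transpose_one_plus_gram] by (simp_all add: B_def)
  let ?C = "matrix_inv B"
  have BC: "B ** ?C = mat 1" "?C ** B = mat 1"
    using posdef_invertible[OF B(1)] by (simp_all add: matrix_inv_right matrix_inv_left)
  have Y: "polar_retr X V = (X + V) ** ?C" by (simp add: polar_retr_def B_def)
  have "X + V = polar_retr X V ** B" by (simp add: Y BC flip: matrix_mul_assoc)
  with B(2) show "\<exists>B. transpose B - B = 0 \<and> X + V = polar_retr X V ** B" by auto
  have "transpose (polar_retr X V) ** polar_retr X V = transpose ?C ** ((transpose (X + V) ** (X + V)) ** ?C)"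
    by (simp only: Y matrix_transpose_mul matrix_mul_assoc)
  also have "\<dots> = transpose ?C ** (B ** (B ** ?C))"
    by (simp only: stiefel_add_gram[OF assms] B(3)[symmetric] matrix_mul_assoc)
  also have "\<dots> = transpose ?C ** transpose B" by (simp only: BC(1) matrix_mul_rid B(2))
  also have "\<dots> = mat 1" by (simp only: BC(1) transpose_mat flip: matrix_transpose_mul)
  finally show "polar_retr X V \<in> stiefel" by (simp add: stiefel_def)
qed

lemma polar_retraction:
  "manifold_retraction (stiefel :: (real ^ ('q::{finite,linorder}) ^ 'n) set) (tangent_bundle stiefel) polar_retr"
  "span_preserving (tangent_bundle (stiefel :: (real ^ ('q::{finite,linorder}) ^ 'n) set)) polar_retr"
proof -
  let ?I = "mat 1 :: real ^ ('q::{finite,linorder}) ^ ('q::{finite,linorder})"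
  have "mat_sqrt ?I = ?I" using mat_sqrt_eq[of ?I] by (simp add: posdef_def)
  moreover have "matrix_inv ?I = ?I"
    using matrix_inv_left[of ?I] by (simp add: invertible_def)
  ultimately have R0: "polar_retr X 0 = X" for X :: "real ^ ('q::{finite,linorder}) ^ 'n"
    by (simp add: polar_retr_def)
  have lin: "linear (\<lambda>T :: real ^ ('q::{finite,linorder}) ^ ('q::{finite,linorder}). transpose T - T)"
    by (intro linear_compose_sub linear_transpose linear_id[unfolded id_def])
  have sk: "T = 0" if "transpose T - T = 0" "transpose T = - T" for T :: "real ^ ('q::{finite,linorder}) ^ ('q::{finite,linorder})"
  proof -
    have "T = - T" using that by simp
    then show ?thesis by (simp add: eq_neg_iff_add_eq_0 flip: scaleR_2)
  qed
  note I = stiefel_retractionI[OF smooth_map_on_polar polar_retr_factor R0 lin sk]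
  show "manifold_retraction (stiefel :: (real ^ ('q::{finite,linorder}) ^ 'n) set) (tangent_bundle stiefel) polar_retr"
    by (rule I(1))
  show "span_preserving (tangent_bundle (stiefel :: (real ^ ('q::{finite,linorder}) ^ 'n) set)) polar_retr"
    by (rule I(2))
qed

section \<open>The projection onto \<open>F\<^sub>v\<close>\<close>

declare transpose_matrix_vector [simp del]

definition outer :: "real^'n \<Rightarrow> real^'q \<Rightarrow> real^'q^'n" where
  "outer a b = (\<chi> i j. a $ i * b $ j)"

lemma bounded_bilinear_outer: "bounded_bilinear (outer :: real^'n \<Rightarrow> real^'q \<Rightarrow> real^'q^'n)"
  unfolding bilinear_conv_bounded_bilinear[symmetric] bilinear_def linear_iff
  by (auto simp: outer_def vec_eq_iff algebra_simps)

interpretation outer: bounded_bilinear "outer :: real^'n \<Rightarrow> real^'q \<Rightarrow> real^'q^'n"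
  by (rule bounded_bilinear_outer)

lemma outer_vector_mult: "outer a b *v x = (b \<bullet> x) *\<^sub>R a"
  by (simp add: outer_def matrix_vector_mult_def inner_vec_def vec_eq_iff sum_distrib_left mult_ac)

lemma transpose_outer: "transpose (outer a b) = outer b a"
  by (simp add: outer_def transpose_def vec_eq_iff mult.commute)

lemma matrix_mult_outer: "A ** outer a b = outer (A *v a) b"
  by (simp add: outer_def matrix_matrix_mult_def matrix_vector_mult_def vec_eq_iff sum_distrib_left sum_distrib_right mult_ac)

lemma outer_matrix_mult: "outer a b ** A = outer a (transpose A *v b)"
  by (metis matrix_mult_outer matrix_transpose_mul transpose_outer transpose_transpose)

lemma inner_outer: "M \<bullet> outer a b = a \<bullet> (M *v b)"
  by (simp add: outer_def inner_vec_def matrix_vector_mult_def sum_distrib_left mult_ac)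

lemma norm_outer_unit: "norm q = 1 \<Longrightarrow> (norm (outer a q))\<^sup>2 = (norm a)\<^sup>2"
  by (simp add: power2_norm_eq_inner inner_outer outer_vector_mult norm_eq_1)

text \<open>\<open>outer (M *v p) p\<close> is M p p^T, and it is Frobenius orthogonal to the
  remainder M (I - p p^T).\<close>

lemma norm_split_outer:
  assumes "norm p = 1"
  shows "(norm M)\<^sup>2 = (norm (M *v p))\<^sup>2 + (norm (M - outer (M *v p) p))\<^sup>2"
proof -
  have "(norm (M - outer (M *v p) p))\<^sup>2 = (norm M)\<^sup>2 - 2 * (M \<bullet> outer (M *v p) p) + (norm (outer (M *v p) p))\<^sup>2"
    by (simp add: power2_norm_eq_inner inner_diff_left inner_diff_right inner_commute)
  then show ?thesis unfolding norm_outer_unit[OF assms] inner_outer by (simp add: power2_norm_eq_inner)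
qed

lemma stiefel_norm: "X \<in> stiefel \<Longrightarrow> norm (X *v x) = norm x"
  using inner_gram[of x X] by (simp add: stiefel_def power2_norm_eq_inner norm_eq_sqrt_inner)

lemma Fv_iff: "X \<in> Fv v \<longleftrightarrow> X \<in> stiefel \<and> v \<in> range ((*v) X)"
  by (simp add: Fv_def span_columns)

lemma Fv_vector:
  assumes "X \<in> Fv v"
  shows "X *v (transpose X *v v) = v" "norm (transpose X *v v) = norm v"
proof -
  obtain y where "v = X *v y" "X \<in> stiefel" using assms by (auto simp: Fv_iff)
  then have "transpose X *v v = y" by (simp add: matrix_vector_mul_assoc stiefel_def)
  then show "X *v (transpose X *v v) = v" "norm (transpose X *v v) = norm v"
    using \<open>v = X *v y\<close> stiefel_norm[OF \<open>X \<in> stiefel\<close>] by simp_all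
qed

text \<open>The paper's \<open>v q\<^sub>*\<^sup>T / \<parallel>v\<parallel> + Y (I - q\<^sub>* q\<^sub>*\<^sup>T)\<close>, written as a rank one update of \<open>Y\<close>.\<close>

definition proj_formula :: "real ^ 'n \<Rightarrow> real ^ 'q ^ 'n \<Rightarrow> real ^ 'q ^ 'n" where
  "proj_formula v Y = (let q = (transpose Y *v v) /\<^sub>R norm (transpose Y *v v)
     in Y + outer (v /\<^sub>R norm v - Y *v q) q)"

text \<open>With s = |Y^T u|, the part of the squared distance along \<open>p\<close> is 2 - 2 s (q
  \<bullet> p). Hence 2 - 2 s is a lower bound, attained only if p = q and the remainder
  \<open>N\<close> is 0; these two conditions determine \<open>Z\<close>.\<close>

lemma proj_Fv_eq:
  fixes Y :: "real^'q^'n"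
  assumes "v \<noteq> 0" "Y \<in> proj_Fv_dom v"
  shows "proj_formula v Y \<in> Fv v" "proj_Fv v Y = proj_formula v Y"
proof -
  have Y: "Y \<in> stiefel" "transpose Y *v v \<noteq> 0" using assms(2) by (auto simp: proj_Fv_dom_def)
  then have YY: "transpose Y ** Y = mat 1" by (simp add: stiefel_def)
  define u where "u = v /\<^sub>R norm v"
  define q where "q = (transpose Y *v v) /\<^sub>R norm (transpose Y *v v)"
  define s where "s = norm (transpose Y *v u)"
  define w where "w = u - Y *v q"
  have u: "norm u = 1" using assms(1) by (simp add: u_def)
  have q: "norm q = 1" using Y(2) by (simp add: q_def)
  have Yu: "transpose Y *v u = s *\<^sub>R q"
    using Y(2) by (simp add: s_def u_def q_def matrix_vector_mult_scaleR)
  have Z: "proj_formula v Y = Y + outer w q" by (simp add: proj_formula_def Let_def q_def w_def u_def)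
  have Yw: "transpose Y *v w = (s - 1) *\<^sub>R q"
    by (simp add: w_def matrix_vector_mult_diff_distrib Yu matrix_vector_mul_assoc YY scaleR_diff_left)
  have uYp: "u \<bullet> (Y *v p) = s * (q \<bullet> p)" for p by (simp add: inner_matrix_vector Yu)
  have uYp2: "(norm (Y *v p - u))\<^sup>2 = 2 - 2 * (s * (q \<bullet> p))" if "norm p = 1" for p
  proof -
    have "(norm (Y *v p - u))\<^sup>2 = (norm (Y *v p))\<^sup>2 + (norm u)\<^sup>2 - 2 * (u \<bullet> (Y *v p))"
      by (simp add: power2_norm_eq_inner inner_diff_left inner_diff_right inner_commute)
    then show ?thesis by (simp add: stiefel_norm[OF Y(1)] that u uYp)
  qed
  have ww: "(norm w)\<^sup>2 = 2 - 2 * s"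
    using uYp2[OF q] q by (simp add: w_def norm_minus_commute norm_eq_1)
  show F: "proj_formula v Y \<in> Fv v"
  proof -
    \<comment> \<open>Each cross term contributes s - 1 times q q^T, and
      \<open>w \<bullet> w\<close> is 2 - 2 s, so the corrections to the Gram matrix cancel.\<close>
    have "transpose (Y + outer w q) ** (Y + outer w q) =
      transpose Y ** Y + outer (transpose Y *v w) q + outer q (transpose Y *v w) + outer q ((w \<bullet> w) *\<^sub>R q)"
      by (simp add: transpose_add transpose_outer mm.add_left mm.add_right matrix_mult_outer
          outer_matrix_mult outer_vector_mult matrix_vector_mult_add_rdistrib outer.add_left
          outer.scaleR_left outer.scaleR_right)
    also have "\<dots> = mat 1 + ((s - 1) + (s - 1) + (w \<bullet> w)) *\<^sub>R outer q q"
      by (simp only: YY Yw outer.scaleR_left outer.scaleR_right scaleR_add_left add.assoc)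
    finally have "Y + outer w q \<in> stiefel"
      using ww by (simp add: stiefel_def power2_norm_eq_inner)
    moreover have "v = (Y + outer w q) *v (norm v *\<^sub>R q)"
      using q assms(1) by (simp add: matrix_vector_mult_scaleR matrix_vector_mult_add_rdistrib
          outer_vector_mult norm_eq_1 w_def u_def)
    ultimately show ?thesis unfolding Z Fv_iff by blast
  qed
  have nZ: "(norm (Y - (Y + outer w q)))\<^sup>2 = 2 - 2 * s"
    using ww norm_outer_unit[OF q, of w] by simp
  have key: "(norm (Y - Z))\<^sup>2 \<ge> 2 - 2 * s \<and> ((norm (Y - Z))\<^sup>2 = 2 - 2 * s \<longrightarrow> Z = Y + outer w q)"
    if ZF: "Z \<in> Fv v" for Z
  proof -
    obtain y where "Z \<in> stiefel" "v = Z *v y" using ZF by (auto simp: Fv_iff)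
    define p where "p = y /\<^sub>R norm v"
    have Zp: "Z *v p = u" by (simp add: p_def u_def matrix_vector_mult_scaleR \<open>v = Z *v y\<close>)
    then have p: "norm p = 1" using stiefel_norm[OF \<open>Z \<in> stiefel\<close>, of p] u by simp
    have s: "0 < s" using Y(2) assms(1) by (simp add: s_def u_def matrix_vector_mult_scaleR)
    have qp: "q \<bullet> p \<le> 1" using norm_cauchy_schwarz[of q p] p q by simp
    define N where "N = (norm ((Y - Z) - outer ((Y - Z) *v p) p))\<^sup>2"
    have N: "(norm (Y - Z))\<^sup>2 = 2 - 2 * (s * (q \<bullet> p)) + N"
      using norm_split_outer[OF p, of "Y - Z"] uYp2[OF p]
      by (simp add: matrix_vector_mult_diff_rdistrib Zp N_def)
    have "0 \<le> N" by (simp add: N_def)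
    have "s * (q \<bullet> p) \<le> s * 1" using s qp by (intro mult_left_mono) auto
    then have "(norm (Y - Z))\<^sup>2 \<ge> 2 - 2 * s" using N \<open>0 \<le> N\<close> by linarith
    moreover have "Z = Y + outer w q" if eq: "(norm (Y - Z))\<^sup>2 = 2 - 2 * s"
    proof -
      have "N = 0" "s * (q \<bullet> p) = s * 1"
        using eq N \<open>0 \<le> N\<close> \<open>s * (q \<bullet> p) \<le> s * 1\<close> by linarith+
      then have "q \<bullet> p = 1" using s by simp
      then have "(norm (q - p))\<^sup>2 = 0"
        using p q by (simp add: power2_norm_eq_inner inner_diff_left inner_diff_right inner_commute norm_eq_1)
      then have "p = q" by simp
      have "Y - Z = outer ((Y - Z) *v p) p" using \<open>N = 0\<close> by (simp add: N_def)
      also have "\<dots> = - outer w q"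
        using Zp by (simp add: \<open>p = q\<close> w_def matrix_vector_mult_diff_rdistrib flip: outer.minus_left)
      finally show ?thesis by (simp add: algebra_simps)
    qed
    ultimately show ?thesis by blast
  qed
  show "proj_Fv v Y = proj_formula v Y"
    unfolding proj_Fv_def
  proof (rule the_equality)
    show "is_arg_min (\<lambda>Z. (norm (Y - Z))\<^sup>2) (\<lambda>Z. Z \<in> Fv v) (proj_formula v Y)"
      unfolding is_arg_min_def Z nZ
    proof (intro conjI notI)
      show "Y + outer w q \<in> Fv v" using F by (simp only: Z)
      assume "\<exists>y. y \<in> Fv v \<and> (norm (Y - y))\<^sup>2 < 2 - 2 * s"
      then show False using key by (meson not_less)
    qed
  next
    fix Z' assume Z': "is_arg_min (\<lambda>Z. (norm (Y - Z))\<^sup>2) (\<lambda>Z. Z \<in> Fv v) Z'"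
    then have "Z' \<in> Fv v" by (simp only: is_arg_min_def)
    moreover have "(norm (Y - Z'))\<^sup>2 \<le> 2 - 2 * s"
      using Z' F unfolding is_arg_min_def Z by (metis nZ not_less)
    ultimately show "Z' = proj_formula v Y" unfolding Z using key[of Z'] by (meson order_antisym)
  qed
qed

lemma proj_Fv_fixed:
  assumes "X \<in> Fv v" "v \<noteq> 0"
  shows "X \<in> proj_Fv_dom v" "proj_Fv v X = X"
proof -
  note X = Fv_vector[OF assms(1)]
  have "transpose X *v v \<noteq> 0" using X(2) assms(2) by auto
  then show dom: "X \<in> proj_Fv_dom v" using assms(1) by (simp add: proj_Fv_dom_def Fv_def)
  show "proj_Fv v X = X"
    unfolding proj_Fv_eq(2)[OF assms(2) dom]
    by (simp add: proj_formula_def Let_def matrix_vector_mult_scaleR X outer.zero_left)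
qed

section \<open>The projected retraction\<close>

lemma perp_times_vector_mult:
  fixes x :: "real^'q"
  shows "perp_times P K *v x = (\<Sum>l<CARD('n) - CARD('q). (K l \<bullet> x) *\<^sub>R (P l :: real^'n))"
proof -
  have "perp_times P K = (\<Sum>l<CARD('n) - CARD('q). outer (P l) (K l))"
    by (simp add: perp_times_def outer_def vec_eq_iff sum_component)
  then show ?thesis
    by (simp add: outer_vector_mult bounded_bilinear.sum_left[OF bounded_bilinear_matrix_vector_mult])
qed

text \<open>Frees later arguments from the chosen completion \<open>P\<close>: X^T V is the skew
  matrix \<open>\<Omega>\<close>, and the condition on \<open>K\<close> says that \<open>V\<close>
  sends X^T v into the column space of \<open>X\<close>.\<close>

lemma tangent_FvD:
  fixes X :: "real^'q^'n"
  assumes "V \<in> tangent_Fv v X"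
  shows "transpose X ** V + transpose V ** X = 0"
    and "V *v (transpose X *v v) = X *v ((transpose X ** V) *v (transpose X *v v))"
proof -
  obtain \<Omega> P K where V: "V = X ** \<Omega> + perp_times P K" and P: "orth_completion X P"
    and \<Omega>: "transpose \<Omega> = - \<Omega>" and K: "\<And>l. l < CARD('n) - CARD('q) \<Longrightarrow> K l \<bullet> (transpose X *v v) = 0"
    using assms by (auto simp: tangent_Fv_def)
  have XX: "transpose X ** X = mat 1" using P by (simp add: orth_completion_def)
  have "transpose X *v P l = 0" if "l < CARD('n) - CARD('q)" for l
    using P that by (simp add: orth_completion_def vec_eq_iff matrix_vector_mult_def transpose_def column_def inner_vec_def)
  then have "transpose X ** perp_times P K = 0"
    unfolding matrix_eq
    by (simp add: matrix_vector_mul_assoc[symmetric] perp_times_vector_mult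
        linear_sum[OF matrix_vector_mul_linear] matrix_vector_mult_scaleR)
  then have XV: "transpose X ** V = \<Omega>" by (simp add: V mm.add_right matrix_mul_assoc XX)
  moreover have "transpose V ** X = transpose \<Omega>" by (simp add: matrix_transpose_mul flip: XV)
  ultimately show "transpose X ** V + transpose V ** X = 0" by (simp add: \<Omega>)
  have "perp_times P K *v (transpose X *v v) = 0" by (simp add: perp_times_vector_mult K)
  then show "V *v (transpose X *v v) = X *v ((transpose X ** V) *v (transpose X *v v))"
    unfolding XV by (simp add: V matrix_vector_mult_add_rdistrib flip: matrix_vector_mul_assoc)
qed

text \<open>Write v = X y with y = X^T v. Skewness gives V^T v = - X^T V y, and applying
  \<open>X\<close> returns - V y because V y lies in the column space of \<open>X\<close>. Pairing
  with v then shows that the number in the second claim equals its own negative.\<close>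

lemma tangent_Fv_orthogonal:
  fixes X :: "real^'q^'n"
  assumes "X \<in> Fv v" "V \<in> tangent_Fv v X"
  shows "X *v (transpose V *v v) = - (V *v (transpose X *v v))"
    and "(transpose V *v v) \<bullet> (transpose X *v v) = 0"
proof -
  let ?y = "transpose X *v v"
  have "transpose V *v v = (transpose V ** X) *v ?y"
    by (simp only: Fv_vector(1)[OF assms(1)] flip: matrix_vector_mul_assoc)
  also have "transpose V ** X = - (transpose X ** V)"
    using tangent_FvD(1)[OF assms(2)] by (simp add: eq_neg_iff_add_eq_0 add.commute)
  also have "(- (transpose X ** V)) *v ?y = - ((transpose X ** V) *v ?y)"
    using matrix_vector_mult_diff_rdistrib[of 0 "transpose X ** V" ?y] by simp
  finally have *: "transpose V *v v = - ((transpose X ** V) *v ?y)" .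
  then show "X *v (transpose V *v v) = - (V *v ?y)"
    by (simp only: tangent_FvD(2)[OF assms(2)] linear_neg[OF matrix_vector_mul_linear])
  have "(transpose V *v v) \<bullet> ?y = v \<bullet> (V *v ?y)" by (simp add: inner_matrix_vector)
  also have "\<dots> = - (v \<bullet> (X *v (transpose V *v v)))"
    by (simp only: \<open>X *v (transpose V *v v) = - (V *v ?y)\<close> inner_minus_right minus_minus)
  also have "\<dots> = - (?y \<bullet> (transpose V *v v))" by (simp only: inner_matrix_vector)
  finally show "(transpose V *v v) \<bullet> ?y = 0" by (simp only: inner_commute[of ?y])
qed

text \<open>The left factor of the rank one correction vanishes at 0 together with its derivative,
  so the correction contributes nothing to first order.\<close>

lemma proj_formula_derivative:
  fixes X :: "real^'q^'n"
  assumes X: "X \<in> Fv v" and V: "V \<in> tangent_Fv v X" and "v \<noteq> 0"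
    and c: "(c has_vector_derivative V) (at 0)" "c 0 = X"
  shows "((\<lambda>t. proj_formula v (c t)) has_vector_derivative V) (at (0 :: real))"
proof -
  define y where "y t = transpose (c t) *v v" for t
  define y' where "y' = transpose V *v v"
  define q where "q t = y t /\<^sub>R norm (y t)" for t
  have dmv: "((\<lambda>t. A t *v x t) has_vector_derivative A 0 *v x' + A' *v x 0) (at 0)"
    if "(A has_vector_derivative A') (at 0)" "(x has_vector_derivative x') (at 0)"
    for A :: "real \<Rightarrow> real^'a^'b" and A' x x'
    by (rule bounded_bilinear.has_vector_derivative[OF bounded_bilinear_matrix_vector_mult that])
  have dy: "(y has_vector_derivative y') (at 0)"
    using dmv[OF has_vector_derivative_transpose[OF c(1)] has_vector_derivative_const[of v]]
    by (simp add: y_def[abs_def] y'_def)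
  have y0: "norm (y 0) = norm v" "y 0 \<noteq> 0"
    using Fv_vector(2)[OF X] \<open>v \<noteq> 0\<close> by (auto simp: y_def c(2))
  have "y' \<bullet> y 0 = 0" using tangent_Fv_orthogonal(2)[OF X V] by (simp add: y_def y'_def c(2))
  \<comment> \<open>Orthogonality of \<open>y'\<close> and \<open>y 0\<close> makes the norm
    stationary, so normalising \<open>y\<close> only rescales its derivative.\<close>
  then have "((\<lambda>t. norm (y t)) has_vector_derivative 0) (at 0)"
    using has_derivative_compose[OF dy[unfolded has_vector_derivative_def] has_derivative_norm[OF y0(2)]]
    by (simp add: has_vector_derivative_def sgn_div_norm)
  then have "((\<lambda>t. inverse (norm (y t))) has_real_derivative 0) (at 0)"
    using DERIV_inverse_fun[of "\<lambda>t. norm (y t)" 0 0 UNIV] y0(2)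
    by (simp add: has_real_derivative_iff_has_vector_derivative)
  from has_vector_derivative_scaleR[OF this dy]
  have dq: "(q has_vector_derivative (y' /\<^sub>R norm v)) (at 0)"
    by (simp add: q_def[abs_def] y0)
  have Xq: "X *v q 0 = v /\<^sub>R norm v"
    by (simp add: q_def y_def c(2) matrix_vector_mult_scaleR Fv_vector[OF X])
  have zero: "X *v (y' /\<^sub>R norm v) + V *v q 0 = 0"
    using tangent_Fv_orthogonal(1)[OF X V]
    by (simp add: q_def y_def y'_def c(2) matrix_vector_mult_scaleR Fv_vector(2)[OF X])
  have "((\<lambda>t. v /\<^sub>R norm v - c t *v q t) has_vector_derivative 0) (at 0)"
    using has_vector_derivative_diff[OF has_vector_derivative_const dmv[OF c(1) dq], of "v /\<^sub>R norm v"] zero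
    by (simp add: c(2))
  from has_vector_derivative_add[OF c(1) outer.has_vector_derivative[OF this dq]]
  show ?thesis
    by (simp add: proj_formula_def Let_def c(2) Xq outer.zero_left flip: y_def q_def)
qed

text \<open>Both requirements are open near (X, 0): membership in \<open>D\<close> relative to the
  bundle, and Y^T v \<noteq> 0 for the value Y of a local smooth extension of \<open>R\<close>. A
  common ball provides the radius.\<close>

lemma retraction_near_zero:
  fixes X :: "real ^ ('q::{finite,linorder}) ^ 'n"
  assumes R: "manifold_retraction stiefel D R" and X: "X \<in> Fv v" and "v \<noteq> 0"
  obtains \<delta> where "\<delta> > 0"
    "\<And>V. transpose X ** V + transpose V ** X = 0 \<Longrightarrow> norm V < \<delta> \<Longrightarrow> (X, V) \<in> D \<and> R X V \<in> proj_Fv_dom v"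
proof -
  have XS: "X \<in> stiefel" using X by (simp add: Fv_def)
  have D: "openin (top_of_set (tangent_bundle stiefel)) D" "(X, 0) \<in> D" "R X 0 = X"
    and sm: "smooth_map_on D (\<lambda>(x, \<eta>). R x \<eta>)" and RS: "\<And>V. (X, V) \<in> D \<Longrightarrow> R X V \<in> stiefel"
    using R XS by (auto simp: manifold_retraction_def)
  obtain T where T: "open T" "D = tangent_bundle stiefel \<inter> T" using D(1) by (auto simp: openin_open)
  have "\<exists>U g. (X, 0) \<in> U \<and> smooth_on_open U g \<and> (\<forall>y\<in>D \<inter> U. g y = (case y of (x, \<eta>) \<Rightarrow> R x \<eta>))"
    using sm D(2) unfolding smooth_map_on_def by (rule bspec)
  then obtain U g where g: "(X, 0) \<in> U" "smooth_on_open U g" "\<forall>y\<in>D \<inter> U. g y = (case y of (x, \<eta>) \<Rightarrow> R x \<eta>)"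
    by (elim exE conjE)
  have U: "open U" "Ck_on 0 U g" using g(2) by (auto simp: smooth_on_open_def simp del: Ck_on.simps)
  define W where "W = U \<inter> (\<lambda>p. transpose (g p) *v v) -` (- {0})"
  have "continuous_on U (\<lambda>p. transpose (g p))" using Ck_on_transpose[OF U] by simp
  then have "continuous_on U (\<lambda>p. transpose (g p) *v v)"
    by (intro bounded_bilinear.continuous_on[OF bounded_bilinear_matrix_vector_mult] continuous_on_const)
  then have "open W" unfolding W_def by (intro continuous_open_preimage U(1)) auto
  have gX: "g (X, 0) = X" using g(1,3) D(2,3) by auto
  have "(X, 0) \<in> W \<inter> T"
    using g(1) D(2) T(2) gX proj_Fv_fixed(1)[OF X \<open>v \<noteq> 0\<close>] by (auto simp: W_def proj_Fv_dom_def)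
  moreover have "open (W \<inter> T)" using \<open>open W\<close> T(1) by blast
  ultimately obtain \<delta> where \<delta>: "\<delta> > 0" "ball (X, 0) \<delta> \<subseteq> W \<inter> T" by (meson open_contains_ball)
  show ?thesis
  proof (rule that[OF \<delta>(1)])
    fix V assume V: "transpose X ** V + transpose V ** X = 0" "norm V < \<delta>"
    have "(X, V) \<in> ball (X, 0) \<delta>" using V(2) by (simp add: dist_Pair_Pair)
    then have in_WT: "(X, V) \<in> W" "(X, V) \<in> T" using \<delta>(2) by auto
    then have "(X, V) \<in> D" using XS V(1) by (simp add: T(2) tangent_bundle_stiefel)
    moreover from this have "g (X, V) = R X V" using g(3) in_WT(1) by (auto simp: W_def)
    ultimately show "(X, V) \<in> D \<and> R X V \<in> proj_Fv_dom v"
      using RS in_WT(1) by (simp add: proj_Fv_dom_def W_def)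
  qed
qed

lemma proj_retr_local:
  fixes X :: "real ^ ('q::{finite,linorder}) ^ 'n"
  assumes R: "manifold_retraction stiefel D R" and X: "X \<in> Fv v" and "v \<noteq> 0"
  shows "\<exists>\<delta>>0.
    (\<forall>V\<in>tangent_Fv v X. norm V < \<delta> \<longrightarrow> (X, V) \<in> proj_retr_dom v D R \<and> proj_retr v R X V \<in> Fv v) \<and>
    proj_retr v R X 0 = X \<and>
    (\<forall>V\<in>tangent_Fv v X. ((\<lambda>t. proj_retr v R X (t *\<^sub>R V)) has_vector_derivative V) (at 0))"
proof -
  have XS: "X \<in> stiefel" using X by (simp add: Fv_def)
  obtain \<delta> where \<delta>: "\<delta> > 0"
    "\<And>V. transpose X ** V + transpose V ** X = 0 \<Longrightarrow> norm V < \<delta> \<Longrightarrow> (X, V) \<in> D \<and> R X V \<in> proj_Fv_dom v"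
    using retraction_near_zero[OF R X \<open>v \<noteq> 0\<close>] by blast
  have R0: "R X 0 = X" using R XS by (simp add: manifold_retraction_def)
  show ?thesis
  proof (intro exI[of _ \<delta>] conjI ballI impI \<delta>(1))
    fix V assume V: "V \<in> tangent_Fv v X"
    note skew = tangent_FvD(1)[OF V]
    show "(X, V) \<in> proj_retr_dom v D R" "proj_retr v R X V \<in> Fv v" if "norm V < \<delta>"
      using \<delta>(2)[OF skew that] V X proj_Fv_eq[OF \<open>v \<noteq> 0\<close>, of "R X V"]
      by (simp_all add: proj_retr_dom_def tangent_bundle_Fv_def proj_retr_def)
    have "((\<lambda>t. R X (t *\<^sub>R V)) has_vector_derivative V) (at 0)"
      using R XS skew by (simp add: manifold_retraction_def tangent_space_stiefel)
    then have d: "((\<lambda>t. proj_formula v (R X (t *\<^sub>R V))) has_vector_derivative V) (at 0)"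
      by (rule proj_formula_derivative[OF X V \<open>v \<noteq> 0\<close>]) (simp add: R0)
    \<comment> \<open>The closed form describes \<open>proj_Fv\<close> only where the minimizer is
      known, hence the restriction to small t; this is enough for a derivative at 0.\<close>
    have eq: "proj_formula v (R X (t *\<^sub>R V)) = proj_retr v R X (t *\<^sub>R V)" if "norm (t *\<^sub>R V) < \<delta>" for t
      using \<delta>(2)[OF skew_scaleR[OF skew] that] proj_Fv_eq(2)[OF \<open>v \<noteq> 0\<close>, of "R X (t *\<^sub>R V)"] by (simp add: proj_retr_def)
    have "((\<lambda>t. norm (t *\<^sub>R V)) \<longlongrightarrow> norm (0 *\<^sub>R V)) (at (0::real))" by (intro tendsto_intros)
    then have "\<forall>\<^sub>F t in at (0::real). norm (t *\<^sub>R V) < \<delta>" using \<delta>(1) by (intro order_tendstoD(2)[of _ 0]) auto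
    then have "\<forall>\<^sub>F t in at 0. proj_formula v (R X (t *\<^sub>R V)) = proj_retr v R X (t *\<^sub>R V)"
      by eventually_elim (rule eq)
    then show "((\<lambda>t. proj_retr v R X (t *\<^sub>R V)) has_vector_derivative V) (at 0)"
      using has_derivative_transform_eventually[OF d[unfolded has_vector_derivative_def]] eq[of 0] \<delta>(1)
      by (simp add: has_vector_derivative_def)
  next
    show "proj_retr v R X 0 = X" by (simp add: proj_retr_def R0 proj_Fv_fixed(2)[OF X \<open>v \<noteq> 0\<close>])
  qed
qed

text \<open>The vector (X + V) X^T v lies in the column space of \<open>Y\<close> and has inner
  product |v|^2 with \<open>v\<close>, because V^T v is orthogonal to X^T v.\<close>

lemma proj_Fv_dom_span:
  fixes X V Y :: "real^'q^'n"
  assumes "X \<in> Fv v" "V \<in> tangent_Fv v X" "v \<noteq> 0"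
    and "Y \<in> stiefel" "span (columns Y) = span (columns (X + V))"
  shows "Y \<in> proj_Fv_dom v"
proof -
  let ?y = "transpose X *v v"
  have "(X + V) *v ?y \<in> range ((*v) Y)" using assms(5) by (simp add: span_columns)
  then obtain x where x: "(X + V) *v ?y = Y *v x" by blast
  have "(transpose Y *v v) \<bullet> x = v \<bullet> ((X + V) *v ?y)" by (simp only: x inner_matrix_vector)
  also have "\<dots> = ?y \<bullet> ?y + (transpose V *v v) \<bullet> ?y"
    by (simp only: matrix_vector_mult_add_rdistrib inner_add_right inner_matrix_vector)
  also have "\<dots> = v \<bullet> v"
    using Fv_vector(2)[OF assms(1)] tangent_Fv_orthogonal(2)[OF assms(1,2)] by (simp add: norm_eq)
  finally have "transpose Y *v v \<noteq> 0" using assms(3) by auto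
  with assms(4) show ?thesis by (simp add: proj_Fv_dom_def)
qed

lemma proj_retr_global:
  fixes R :: "real ^ ('q::{finite,linorder}) ^ 'n \<Rightarrow> _"
  assumes R: "manifold_retraction stiefel (tangent_bundle stiefel) R"
    and sp: "span_preserving (tangent_bundle stiefel) R" and "v \<noteq> 0"
  shows "proj_retr_dom v (tangent_bundle stiefel) R = tangent_bundle_Fv v"
    and "\<forall>(X, V)\<in>tangent_bundle_Fv v. proj_retr v R X V \<in> Fv v"
proof -
  have *: "(X, V) \<in> tangent_bundle stiefel \<and> R X V \<in> proj_Fv_dom v" if "(X, V) \<in> tangent_bundle_Fv v" for X V
  proof -
    have X: "X \<in> Fv v" and V: "V \<in> tangent_Fv v X" using that by (auto simp: tangent_bundle_Fv_def)
    have XV: "(X, V) \<in> tangent_bundle stiefel"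
      using X tangent_FvD(1)[OF V] by (simp add: tangent_bundle_stiefel Fv_def)
    then have "R X V \<in> stiefel" "span (columns (R X V)) = span (columns (X + V))"
      using R sp by (auto simp: manifold_retraction_def span_preserving_def)
    with XV show ?thesis using proj_Fv_dom_span[OF X V \<open>v \<noteq> 0\<close>] by blast
  qed
  then show "proj_retr_dom v (tangent_bundle stiefel) R = tangent_bundle_Fv v"
    by (auto simp: proj_retr_dom_def)
  show "\<forall>(X, V)\<in>tangent_bundle_Fv v. proj_retr v R X V \<in> Fv v"
  proof clarify
    fix X V :: "real ^ ('q::{finite,linorder}) ^ 'n" assume "(X, V) \<in> tangent_bundle_Fv v"
    then show "proj_retr v R X V \<in> Fv v"
      using * proj_Fv_eq[OF \<open>v \<noteq> 0\<close>, of "R X V"] by (simp add: proj_retr_def)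
  qed
qed

theorem theorem3p4:
  fixes v :: "real ^ 'n"
  assumes "\<forall>i. 0 < v $ i"
  shows
    "(\<forall>(D :: ((real ^ ('q::{finite,linorder}) ^ 'n) \<times> (real ^ ('q::{finite,linorder}) ^ 'n)) set) Rt.
       manifold_retraction stiefel D Rt \<longrightarrow>
       (\<forall>X\<in>Fv v. \<exists>\<delta>>0.
          (\<forall>V\<in>tangent_Fv v X. norm V < \<delta> \<longrightarrow>
             (X, V) \<in> proj_retr_dom v D Rt \<and> proj_retr v Rt X V \<in> Fv v) \<and>
          proj_retr v Rt X 0 = X \<and>
          (\<forall>V\<in>tangent_Fv v X.
             ((\<lambda>t. proj_retr v Rt X (t *\<^sub>R V)) has_vector_derivative V) (at 0))) \<and>
       (D = tangent_bundle stiefel \<and> span_preserving D Rt \<longrightarrow>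
          proj_retr_dom v D Rt = tangent_bundle_Fv v \<and>
          (\<forall>(X, V)\<in>tangent_bundle_Fv v. proj_retr v Rt X V \<in> Fv v))) \<and>
     manifold_retraction (stiefel :: (real ^ ('q::{finite,linorder}) ^ 'n) set) (tangent_bundle stiefel)
           (\<lambda>X V. qf (X + V)) \<and>
     span_preserving (tangent_bundle (stiefel :: (real ^ ('q::{finite,linorder}) ^ 'n) set)) (\<lambda>X V. qf (X + V)) \<and>
     manifold_retraction (stiefel :: (real ^ ('q::{finite,linorder}) ^ 'n) set) (tangent_bundle stiefel) polar_retr \<and>
     span_preserving (tangent_bundle (stiefel :: (real ^ ('q::{finite,linorder}) ^ 'n) set)) polar_retr"
proof -
  have "v \<noteq> 0" using assms by auto
  show ?thesis
  proof (intro conjI qf_retraction polar_retraction allI impI)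
    fix D :: "((real ^ ('q::{finite,linorder}) ^ 'n) \<times> (real ^ ('q::{finite,linorder}) ^ 'n)) set" and Rt
    assume R: "manifold_retraction stiefel D Rt"
    show "\<forall>X\<in>Fv v. \<exists>\<delta>>0.
          (\<forall>V\<in>tangent_Fv v X. norm V < \<delta> \<longrightarrow>
             (X, V) \<in> proj_retr_dom v D Rt \<and> proj_retr v Rt X V \<in> Fv v) \<and>
          proj_retr v Rt X 0 = X \<and>
          (\<forall>V\<in>tangent_Fv v X.
             ((\<lambda>t. proj_retr v Rt X (t *\<^sub>R V)) has_vector_derivative V) (at 0))"
      by (intro ballI proj_retr_local[OF R _ \<open>v \<noteq> 0\<close>])
    assume D: "D = tangent_bundle stiefel \<and> span_preserving D Rt"
    then have D1: "D = tangent_bundle stiefel" and D2: "span_preserving (tangent_bundle stiefel) Rt"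
      by auto
    note global = proj_retr_global[OF R[unfolded D1] D2 \<open>v \<noteq> 0\<close>]
    show "proj_retr_dom v D Rt = tangent_bundle_Fv v" unfolding D1 by (rule global(1))
    show "\<forall>(X, V)\<in>tangent_bundle_Fv v. proj_retr v Rt X V \<in> Fv v" by (rule global(2))
  qed
qed

end
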